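(* Let $\mathfrak{g}=gl(n,\mathbb{C})$, $\mathcal{M}=\mathrm{End}(\mathbb{C}^n)$, and consider an ordered set of $k$ positive integers $n_1\ge n_2\ge\dots\ge n_k$ with $\sum_{i=1}^kn_i=n$. The invariant part of the reflection equation (RE) Poisson bracket $r^{\mathrm{ad},\mathrm{ad}}+(\omega^{r,l}-\omega^{l,r})$ on the homogeneous space $O_{[n_1,\dots,n_k]}$ is induced by the right-invariant bivector field $$\sum_{\bar\alpha_{ij}\in\Pi^+_{\mathfrak{g}/\mathfrak{l}}}\frac{\lambda_i+\lambda_j}{\lambda_i-\lambda_j}\sum_{\alpha\in\bar\alpha_{ij}}\bigl(e_\alpha\otimes e_{-\alpha}-e_{-\alpha}\otimes e_\alpha\bigr),$$ where the $k$ pairwise distinct complex numbers $\lambda_1,\dots,\lambda_k$ are such that the pairs $(n_i,\lambda_i)$, $i=1,\dots,k$, form a decreasing sequence. (Here the RE bracket on $O_{[n_1,\dots,n_k]}$ is the one obtained by realizing this space as the orbit $O_{[n_1,\dots,n_k;\lambda_1,\dots,\lambda_k]}\subset\mathcal{M}$ and restricting the RE bracket of $\mathcal{M}$ to it.)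
   Context: Let $G=GL(n,\mathbb{C})$ act on $\mathcal{M}$ on the right by conjugation $A\mapsto g^{-1}Ag$. Let $G_{[n_1,\dots,n_k]}=GL(n_1)\times\dots\times GL(n_k)\subset G$ be the block-diagonal Levi subgroup, $\mathfrak{l}$ its Lie algebra, and $O_{[n_1,\dots,n_k]}=G_{[n_1,\dots,n_k]}\backslash G$ the right coset space. Let $P_{n_i}$ be the diagonal projector onto the $i$-th summand of $\mathbb{C}^n=\mathbb{C}^{n_1}\oplus\dots\oplus\mathbb{C}^{n_k}$. For pairwise distinct $\lambda_i\in\mathbb{C}$, $O_{[n_1,\dots,n_k;\lambda_1,\dots,\lambda_k]}\subset\mathcal{M}$ is the conjugation orbit of the point $\sum_i\lambda_iP_{n_i}$; it is isomorphic to $O_{[n_1,\dots,n_k]}$ with this point as the origin. Ordering: on $\mathbb{C}$, $\lambda_1\succ\lambda_2$ iff $\mathrm{Re}\,\lambda_1>\mathrm{Re}\,\lambda_2$, or $\mathrm{Re}\,\lambda_1=\mathrm{Re}\,\lambda_2$ and $\mathrm{Im}\,\lambda_1>\mathrm{Im}\,\lambda_2$; on $\mathbb{N}\times\mathbb{C}$, $(n_1,\lambda_1)\succ(n_2,\lambda_2)$ iff $n_1>n_2$, or $n_1=n_2$ and $\lambda_1\succ\lambda_2$. RE bracket: with matrix units $e^i_j$ ($e^i_je^l_k=\delta^l_je^i_k$), $r=\sum_{i<j}(e^j_i\otimes e^i_j-e^i_j\otimes e^j_i)$ and $\omega=\sum_{i,j}e^i_j\otimes e^j_i$. For $\xi\in\mathfrak{g}$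 put $(\xi^lf)(A)=df(A\xi)$, $(\xi^rf)(A)=df(\xi A)$ (differential at $A$), $\xi^{\mathrm{ad}}=\xi^l-\xi^r$; $\psi^{a,b}$ denotes the bidifferential operator $(f,g)\mapsto(\psi_1^af)(\psi_2^bg)$ for $\psi=\psi_1\otimes\psi_2$. The RE Poisson bracket on $\mathcal{M}$ is $r^{\mathrm{ad},\mathrm{ad}}+(\omega^{r,l}-\omega^{l,r})$; its invariant part is $\omega^{r,l}-\omega^{l,r}$. Quasi-roots: the roots of $\mathfrak{g}$ with respect to the diagonal Cartan subalgebra are $\alpha=e^a_a-e^b_b$, $a\ne b$ (identified via the trace form), with root vectors $e_\alpha=e^a_b$ and $e_{-\alpha}=e^b_a$, so $(e_\alpha,e_{-\alpha})=\mathrm{Tr}(e_\alpha e_{-\alpha})=1$. The quasi-roots $\Pi_{\mathfrak{g}/\mathfrak{l}}$ are the classes of roots of $\mathfrak{g}$ not in $\mathfrak{l}$ modulo $\mathbb{Z}\Pi_{\mathfrak{l}}$ (with $\Pi_{\mathfrak{l}}$ the roots of $\mathfrak{l}$); they are labeled by pairs $i\ne j$ in $\{1,\dots,k\}$, where $\bar\alpha_{ij}$ is the set of roots $e^a_a-e^b_b$ such that $e^a_aP_{n_i}=e^a_a$ and $e^b_bP_{n_j}=e^b_b$. $\Pi^+_{\mathfrak{g}/\mathfrak{l}}$ consists of the $\bar\alpha_{ij}$ with $i<j$. The $\mathfrak{l}$-invariant element displayed in the claim, viewed in $\wedge^2(\mathfrak{g}/\mathfrak{l})=\wedge^2T_o(G_{[n_1,\dots,n_k]}\backslash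 G)$ at the origin $o$, determines a unique $G$-invariant bivector field on the homogeneous space (under the realization in $\mathcal{M}$, $\xi\in\mathfrak{g}$ represents the tangent vector $[A,\xi]$ at $A$). *)

theory Defs
  imports "HOL-Analysis.Analysis" "HOL-Algebra.Coset"
begin

section \<open>Matrices, tensors and bidifferential operators\<close>

type_synonym 'n cmat = "complex^'n^'n"

definition munit :: "'n::finite \<Rightarrow> 'n \<Rightarrow> 'n cmat" where
  "munit i j = axis i (axis j 1)"

text \<open>An element of \<open>\<gg> \<otimes> \<gg>\<close> is given by its coordinates: the entry at \<open>(i, j, k, l)\<close> is the
  coefficient of \<open>munit i j \<otimes> munit k l\<close>.\<close>

type_synonym 'n tensor2 = "complex^('n \<times> 'n \<times> 'n \<times> 'n)"

definition tensor :: "('n::finite) cmat \<Rightarrow> 'n cmat \<Rightarrow> 'n tensor2" where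
  "tensor X Y = vec_lambda (\<lambda>(i, j, k, l). X $ i $ j * Y $ k $ l)"

text \<open>Complex differentiability on an open set of matrices.  The Frechet derivative of the library
  is only real linear, so complex linearity is required explicitly; \<open>mat c ** X\<close> is the scalar
  multiple of \<open>X\<close> by the complex number \<open>c\<close>.\<close>

definition mholomorphic_on :: "(('n::finite) cmat \<Rightarrow> complex) \<Rightarrow> 'n cmat set \<Rightarrow> bool" where
  "mholomorphic_on f U \<longleftrightarrow> open U \<and> (\<forall>A\<in>U. f differentiable (at A) \<and>
     (\<forall>c X. frechet_derivative f (at A) (mat c ** X) = c * frechet_derivative f (at A) X))"

type_synonym 'n operator = "('n cmat \<Rightarrow> complex) \<Rightarrow> 'n cmat \<Rightarrow> complex"
type_synonym 'n bioperator =
  "('n cmat \<Rightarrow> complex) \<Rightarrow> ('n cmat \<Rightarrow> complex) \<Rightarrow> 'n cmat \<Rightarrow> complex"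

definition act_l :: "('n::finite) cmat \<Rightarrow> 'n operator" where
  "act_l \<xi> f A = frechet_derivative f (at A) (A ** \<xi>)"

definition act_r :: "('n::finite) cmat \<Rightarrow> 'n operator" where
  "act_r \<xi> f A = frechet_derivative f (at A) (\<xi> ** A)"

definition act_ad :: "('n::finite) cmat \<Rightarrow> 'n operator" where
  "act_ad \<xi> f A = act_l \<xi> f A - act_r \<xi> f A"

definition bidiff :: "'n tensor2 \<Rightarrow> (('n::finite) cmat \<Rightarrow> 'n operator) \<Rightarrow>
    ('n cmat \<Rightarrow> 'n operator) \<Rightarrow> 'n bioperator" where
  "bidiff \<psi> a b f h A =
     (\<Sum>(i, j, k, l)\<in>UNIV. \<psi> $ (i, j, k, l) * (a (munit i j) f A * b (munit k l) h A))"

section \<open>The reflection equation bracket\<close>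

definition r_tensor :: "('n::{finite,linorder}) tensor2" where
  "r_tensor = (\<Sum>(i, j)\<in>{(i, j). i < j}.
     tensor (munit j i) (munit i j) - tensor (munit i j) (munit j i))"

definition omega_tensor :: "('n::finite) tensor2" where
  "omega_tensor = (\<Sum>i\<in>UNIV. \<Sum>j\<in>UNIV. tensor (munit i j) (munit j i))"

definition RE_invariant_part :: "('n::finite) bioperator" where
  "RE_invariant_part f h A =
     bidiff omega_tensor act_r act_l f h A - bidiff omega_tensor act_l act_r f h A"

definition RE_bracket :: "('n::{finite,linorder}) bioperator" where
  "RE_bracket f h A = bidiff r_tensor act_ad act_ad f h A + RE_invariant_part f h A"

section \<open>The Levi subgroup, the homogeneous space and the orbit\<close>

text \<open>The basis of \<open>\<complex>\<^sup>n\<close> is indexed by a finite linearly ordered type; \<open>card {b. b < a}\<close> is the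
  position of \<open>a\<close>, counted from \<open>0\<close>.  The blocks are consecutive, with sizes \<open>ns 1, \<dots>, ns k\<close>.\<close>

definition block :: "(nat \<Rightarrow> nat) \<Rightarrow> nat \<Rightarrow> ('n::{finite,linorder}) set" where
  "block ns i = {a. (\<Sum>m\<in>{1..<i}. ns m) \<le> card {b. b < a} \<and> card {b. b < a} < (\<Sum>m\<in>{1..i}. ns m)}"

definition block_proj :: "(nat \<Rightarrow> nat) \<Rightarrow> nat \<Rightarrow> ('n::{finite,linorder}) cmat" where
  "block_proj ns i = (\<chi> a b. if a = b \<and> a \<in> block ns i then 1 else 0)"

definition GL :: "('n::finite) cmat monoid" where
  "GL = \<lparr>carrier = {g. invertible g}, mult = (**), one = mat 1\<rparr>"

definition levi :: "(nat \<Rightarrow> nat) \<Rightarrow> nat \<Rightarrow> ('n::{finite,linorder}) cmat set" where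
  "levi ns k = {g \<in> carrier GL.
     \<forall>a b. (\<nexists>i. i \<in> {1..k} \<and> a \<in> block ns i \<and> b \<in> block ns i) \<longrightarrow> g $ a $ b = 0}"

definition homog :: "(nat \<Rightarrow> nat) \<Rightarrow> nat \<Rightarrow> ('n::{finite,linorder}) cmat set set" where
  "homog ns k = rcosets\<^bsub>GL\<^esub> (levi ns k)"

definition quot_map ::
    "(nat \<Rightarrow> nat) \<Rightarrow> nat \<Rightarrow> ('n::{finite,linorder}) cmat \<Rightarrow> 'n cmat set" where
  "quot_map ns k g = levi ns k #>\<^bsub>GL\<^esub> g"

definition conj_act :: "('n::finite) cmat \<Rightarrow> 'n cmat \<Rightarrow> 'n cmat" where
  "conj_act A g = matrix_inv g ** A ** g"

definition base_point ::
    "(nat \<Rightarrow> nat) \<Rightarrow> nat \<Rightarrow> (nat \<Rightarrow> complex) \<Rightarrow> ('n::{finite,linorder}) cmat" where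
  "base_point ns k ev = (\<Sum>i\<in>{1..k}. mat (ev i) ** block_proj ns i)"

definition orbit ::
    "(nat \<Rightarrow> nat) \<Rightarrow> nat \<Rightarrow> (nat \<Rightarrow> complex) \<Rightarrow> ('n::{finite,linorder}) cmat set" where
  "orbit ns k ev = conj_act (base_point ns k ev) ` carrier GL"

text \<open>The map from cosets to the orbit; \<open>g \<mapsto> g\<^sup>-\<^sup>1 A g\<close> is constant on each coset, where \<open>A\<close> is the
  base point.\<close>

definition realize :: "(nat \<Rightarrow> nat) \<Rightarrow> nat \<Rightarrow> (nat \<Rightarrow> complex) \<Rightarrow>
    'n cmat set \<Rightarrow> ('n::{finite,linorder}) cmat" where
  "realize ns k ev x = the_elem (conj_act (base_point ns k ev) ` x)"

text \<open>A function on the coset space is holomorphic near a point when its pullback along the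
  quotient submersion is holomorphic near every representative.\<close>

definition holomorphic_near :: "(nat \<Rightarrow> nat) \<Rightarrow> nat \<Rightarrow>
    ('n cmat set \<Rightarrow> complex) \<Rightarrow> ('n::{finite,linorder}) cmat set \<Rightarrow> bool" where
  "holomorphic_near ns k \<phi> x \<longleftrightarrow>
     (\<forall>g\<in>x. \<exists>V. g \<in> V \<and> V \<subseteq> carrier GL \<and> mholomorphic_on (\<phi> \<circ> quot_map ns k) V)"

section \<open>Restricting a bracket of matrices to the homogeneous space\<close>

definition local_extension :: "(nat \<Rightarrow> nat) \<Rightarrow> nat \<Rightarrow> (nat \<Rightarrow> complex) \<Rightarrow>
    ('n cmat \<Rightarrow> complex) \<Rightarrow> ('n cmat set \<Rightarrow> complex) \<Rightarrow>
    ('n::{finite,linorder}) cmat set \<Rightarrow> bool" where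
  "local_extension ns k ev f \<phi> x \<longleftrightarrow>
     (\<exists>U. realize ns k ev x \<in> U \<and> mholomorphic_on f U \<and>
       (\<forall>y\<in>homog ns k. realize ns k ev y \<in> U \<longrightarrow> f (realize ns k ev y) = \<phi> y))"

text \<open>\<open>c\<close> is a value at \<open>x\<close> of the bracket of \<open>\<phi>\<close> and \<open>\<eta>\<close>, computed through some local extensions.\<close>

definition restricted_value :: "(nat \<Rightarrow> nat) \<Rightarrow> nat \<Rightarrow> (nat \<Rightarrow> complex) \<Rightarrow> 'n bioperator \<Rightarrow>
    ('n cmat set \<Rightarrow> complex) \<Rightarrow> ('n cmat set \<Rightarrow> complex) \<Rightarrow>
    ('n::{finite,linorder}) cmat set \<Rightarrow> complex \<Rightarrow> bool" where
  "restricted_value ns k ev B \<phi> \<eta> x c \<longleftrightarrow>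
     (\<exists>f h. local_extension ns k ev f \<phi> x \<and> local_extension ns k ev h \<eta> x \<and>
       c = B f h (realize ns k ev x))"

definition restricts_to_homog :: "(nat \<Rightarrow> nat) \<Rightarrow> nat \<Rightarrow> (nat \<Rightarrow> complex) \<Rightarrow>
    ('n::{finite,linorder}) bioperator \<Rightarrow> bool" where
  "restricts_to_homog ns k ev B \<longleftrightarrow>
     (\<forall>x\<in>homog ns k. \<forall>\<phi> \<eta>. holomorphic_near ns k \<phi> x \<longrightarrow> holomorphic_near ns k \<eta> x \<longrightarrow>
       (\<exists>!c. restricted_value ns k ev B \<phi> \<eta> x c))"

definition restricted_bracket :: "(nat \<Rightarrow> nat) \<Rightarrow> nat \<Rightarrow> (nat \<Rightarrow> complex) \<Rightarrow> 'n bioperator \<Rightarrow>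
    ('n cmat set \<Rightarrow> complex) \<Rightarrow> ('n cmat set \<Rightarrow> complex) \<Rightarrow>
    ('n::{finite,linorder}) cmat set \<Rightarrow> complex" where
  "restricted_bracket ns k ev B \<phi> \<eta> x = (THE c. restricted_value ns k ev B \<phi> \<eta> x c)"

text \<open>The right-invariant bivector field on the group determined by \<open>\<psi>\<close> differentiates at \<open>g\<close> along
  \<open>\<xi> ** g\<close>, which is what \<open>act_r\<close> does.  It induces the bivector field \<open>B\<close> on the coset space when the
  two are related by the quotient map: the value must be the same at all representatives of a
  coset.  Such a \<open>B\<close> is invariant under right translations, and at the origin it is the class of
  \<open>\<psi>\<close> modulo the Lie algebra of the Levi subgroup.\<close>

definition right_invariant_bivector :: "('n::finite) tensor2 \<Rightarrow> 'n bioperator" where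
  "right_invariant_bivector \<psi> = bidiff \<psi> act_r act_r"

definition induced_by_right_invariant :: "(nat \<Rightarrow> nat) \<Rightarrow> nat \<Rightarrow> 'n tensor2 \<Rightarrow>
    ((('n::{finite,linorder}) cmat set \<Rightarrow> complex) \<Rightarrow> ('n cmat set \<Rightarrow> complex) \<Rightarrow>
      'n cmat set \<Rightarrow> complex) \<Rightarrow> bool" where
  "induced_by_right_invariant ns k \<psi> B \<longleftrightarrow>
     (\<forall>x\<in>homog ns k. \<forall>\<phi> \<eta>. holomorphic_near ns k \<phi> x \<longrightarrow> holomorphic_near ns k \<eta> x \<longrightarrow>
       (\<forall>g\<in>x. B \<phi> \<eta> x =
          right_invariant_bivector \<psi> (\<phi> \<circ> quot_map ns k) (\<eta> \<circ> quot_map ns k) g))"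

section \<open>Quasi-roots\<close>

text \<open>Roots are identified with diagonal matrices through the trace form.\<close>

definition roots :: "('n::finite) cmat set" where
  "roots = {munit a a - munit b b | a b. a \<noteq> b}"

definition root_vector :: "('n::finite) cmat \<Rightarrow> 'n cmat" where
  "root_vector \<alpha> = (THE X. \<exists>a b. a \<noteq> b \<and> \<alpha> = munit a a - munit b b \<and> X = munit a b)"

definition quasi_root :: "(nat \<Rightarrow> nat) \<Rightarrow> nat \<Rightarrow> nat \<Rightarrow> ('n::{finite,linorder}) cmat set" where
  "quasi_root ns i j = {\<alpha> \<in> roots. \<exists>a b. \<alpha> = munit a a - munit b b \<and>
     munit a a ** block_proj ns i = munit a a \<and> munit b b ** block_proj ns j = munit b b}"

definition quasi_root_bivector ::
    "(nat \<Rightarrow> nat) \<Rightarrow> nat \<Rightarrow> (nat \<Rightarrow> complex) \<Rightarrow> ('n::{finite,linorder}) tensor2" where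
  "quasi_root_bivector ns k ev =
     (\<Sum>(i, j)\<in>{(i, j). 1 \<le> i \<and> i < j \<and> j \<le> k}. ((ev i + ev j) / (ev i - ev j)) *s
       (\<Sum>\<alpha>\<in>quasi_root ns i j.
          tensor (root_vector \<alpha>) (root_vector (- \<alpha>)) - tensor (root_vector (- \<alpha>)) (root_vector \<alpha>)))"

section \<open>The ordering on pairs\<close>

definition csucc :: "complex \<Rightarrow> complex \<Rightarrow> bool" where
  "csucc z w \<longleftrightarrow> Re z > Re w \<or> (Re z = Re w \<and> Im z > Im w)"

definition psucc :: "nat \<times> complex \<Rightarrow> nat \<times> complex \<Rightarrow> bool" where
  "psucc p q \<longleftrightarrow> fst p > fst q \<or> (fst p = fst q \<and> csucc (snd p) (snd q))"

end

theory Submission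
  imports Defs
begin

text \<open>Write \<open>A = g\<^sup>-\<^sup>1 D g\<close> with \<open>D\<close> the base point and \<open>d\<^sub>a\<close> its diagonal entries.  Differentiating
  \<open>g \<mapsto> f (g\<^sup>-\<^sup>1 D g)\<close> shows that \<open>\<phi> \<circ> quot_map\<close>, for an extension \<open>f\<close> of \<open>\<phi>\<close>, has derivative
  \<open>df\<^sub>A (A X - X A)\<close> along \<open>g X\<close>; for \<open>g X = e\<^sup>a\<^sub>b g\<close> this is \<open>(d\<^sub>a - d\<^sub>b) f\<^sub>a\<^sub>b\<close>, where
  \<open>f\<^sub>a\<^sub>b = df\<^sub>A (g\<^sup>-\<^sup>1 e\<^sup>a\<^sub>b g)\<close>.  As \<open>\<omega>\<close> is invariant under conjugation, the invariant part of the
  bracket at \<open>A\<close> is the sum of \<open>(d\<^sub>b\<^sup>2 - d\<^sub>a\<^sup>2) f\<^sub>a\<^sub>b h\<^sub>b\<^sub>a\<close>, and the factor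
  \<open>(\<lambda>\<^sub>i + \<lambda>\<^sub>j) / (\<lambda>\<^sub>i - \<lambda>\<^sub>j)\<close> turns \<open>(d\<^sub>a - d\<^sub>b) (d\<^sub>b - d\<^sub>a)\<close> into the same coefficient.  Local
  extensions exist because the orbit map has local holomorphic sections.\<close>

section \<open>Complex matrices\<close>

text \<open>Feeds the interpretation \<open>mmult\<close>, the source of the distributive laws and
  of the product rule for derivatives.\<close>

lemma bilinear_matrix_mult:
  "bilinear ((**) :: complex^'n^'m \<Rightarrow> complex^'p^'n \<Rightarrow> complex^'p^'m)"
  unfolding bilinear_def
  by (auto intro!: linearI
      simp: vec_eq_iff matrix_matrix_mult_def sum.distrib scaleR_sum_right algebra_simps)

interpretation mmult: bounded_bilinear "(**) :: 'n::finite cmat \<Rightarrow> 'n cmat \<Rightarrow> 'n cmat"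
  using bilinear_matrix_mult by (simp add: bilinear_conv_bounded_bilinear)

lemma mat_mult_nth: "(mat c ** X) $ i $ j = c * X $ i $ j"
  for c :: "'a::semiring_1"
  unfolding matrix_matrix_mult_def mat_def
  by (simp add: if_distrib [where f = "\<lambda>x. x * _"] cong: if_cong)

lemma mult_mat_nth: "(X ** mat c) $ i $ j = X $ i $ j * c"
  for c :: "'a::semiring_1"
  unfolding matrix_matrix_mult_def mat_def
  by (simp add: if_distrib [where f = "\<lambda>x. _ * x"] cong: if_cong)

lemma mat_mult_commute: "mat c ** X = X ** mat c"
  for c :: "'a::comm_semiring_1"
  by (simp add: vec_eq_iff mat_mult_nth mult_mat_nth mult.commute)

lemma mat_mult_left_commute: "X ** (mat c ** Y) = mat c ** (X ** Y)"
  for c :: "'a::comm_semiring_1"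
  by (metis mat_mult_commute matrix_mul_assoc)

lemma munit_nth: "munit i j $ a $ b = (if a = i \<and> b = j then 1 else 0)"
  by (auto simp: munit_def axis_def)

text \<open>The product is the outer product of column \<open>i\<close> of \<open>X\<close> and row
  \<open>j\<close> of \<open>Y\<close>.\<close>

lemma munit_conj_nth: "(X ** munit i j ** Y) $ a $ b = X $ a $ i * Y $ j $ b"
proof -
  have "(X ** munit i j) $ a $ l = (if l = j then X $ a $ i else 0)" for l
    by (auto simp: matrix_matrix_mult_def munit_nth if_distrib [where f = "\<lambda>x. _ * x"] cong: if_cong)
  then show ?thesis
    by (simp add: matrix_matrix_mult_def [of "X ** munit i j"]
        if_distrib [where f = "\<lambda>x. x * _"] cong: if_cong)
qed

lemma munit_mult_munit: "munit i j ** munit k l = (if j = k then munit i l else 0)"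
  using munit_conj_nth [of "mat 1" i j "munit k l", unfolded matrix_mul_lid]
  by (auto simp: vec_eq_iff munit_nth mat_def)

section \<open>Diagonal matrices and their action on matrix units\<close>

definition diag :: "('n::finite \<Rightarrow> complex) \<Rightarrow> 'n cmat" where
  "diag d = (\<chi> a b. if a = b then d a else 0)"

lemma diag_mult_nth: "(diag d ** X) $ a $ b = d a * X $ a $ b"
  unfolding matrix_matrix_mult_def diag_def
  by (simp add: if_distrib [where f = "\<lambda>x. x * _"] cong: if_cong)

lemma mult_diag_nth: "(X ** diag d) $ a $ b = X $ a $ b * d b"
  unfolding matrix_matrix_mult_def diag_def
  by (simp add: if_distrib [where f = "\<lambda>x. _ * x"] cong: if_cong)

text \<open>Matrix units are eigenvectors of left and, by the next lemma, right multiplication by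
  \<open>diag d\<close>; so the bivectors are compared in a conjugate of this basis.\<close>

lemma diag_mult_munit: "diag d ** munit a b = mat (d a) ** munit a b"
  by (auto simp: vec_eq_iff diag_mult_nth mat_mult_nth munit_nth)

lemma munit_mult_diag: "munit a b ** diag d = mat (d b) ** munit a b"
  by (auto simp: vec_eq_iff mult_diag_nth mat_mult_nth munit_nth)

lemma diag_mult_diag: "diag d ** diag e = diag (\<lambda>a. d a * e a)"
  by (simp add: vec_eq_iff diag_mult_nth) (simp add: diag_def)

lemma mat_eq_diag: "mat c = diag (\<lambda>_. c)"
  by (simp add: mat_def diag_def)

lemma diag_minus_diag: "diag d - diag e = diag (\<lambda>a. d a - e a)"
  by (simp add: diag_def vec_eq_iff)

lemma sum_munit_diag: "(\<Sum>a\<in>UNIV. munit a a) = mat 1"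
  by (auto simp: vec_eq_iff munit_nth mat_def intro: sum.neutral)

section \<open>Inverses and conjugation\<close>

lemma matrix_inv_mult:
  assumes "invertible (g :: 'n::finite cmat)"
  shows "matrix_inv g ** g = mat 1" "g ** matrix_inv g = mat 1"
  using assms unfolding invertible_def matrix_inv_def by (rule someI2_ex, blast)+

lemma matrix_inv_eqI:
  assumes "g ** h = mat 1" "h ** g = mat 1"
  shows "matrix_inv g = (h :: 'n::finite cmat)"
  by (metis assms invertible_def matrix_inv_mult(2) matrix_mul_assoc matrix_mul_lid matrix_mul_rid)

lemma invertible_conj_cancel:
  assumes "invertible (g :: 'n::finite cmat)"
  shows "g ** (matrix_inv g ** X) = X" "matrix_inv g ** (g ** X) = X"
    "X ** g ** matrix_inv g = X" "X ** matrix_inv g ** g = X"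
  using matrix_inv_mult [OF assms] by (metis matrix_mul_assoc matrix_mul_lid matrix_mul_rid)+

lemma invertible_matrix_inv: "invertible g \<Longrightarrow> invertible (matrix_inv (g :: 'n::finite cmat))"
  using matrix_inv_mult invertible_def by blast

text \<open>Multiply by \<open>g\<close> on the left and by the inverse of \<open>g'\<close> on the
  right. This reduces the fibres of the orbit map to the centralizer of \<open>A\<close>.\<close>

lemma conj_act_eq_iff:
  assumes "invertible g" "invertible g'"
  shows "conj_act A g = conj_act A g' \<longleftrightarrow> A ** (g ** matrix_inv g') = (g ** matrix_inv g') ** A"
    (is "?L \<longleftrightarrow> ?R")
proof
  assume ?L
  then have "g ** (matrix_inv g ** A ** g) ** matrix_inv g'
      = g ** (matrix_inv g' ** A ** g') ** matrix_inv g'"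
    by (simp add: conj_act_def)
  then show ?R
    using assms by (simp add: matrix_mul_assoc [symmetric] invertible_conj_cancel matrix_inv_mult)
next
  assume ?R
  then have "matrix_inv g ** (A ** (g ** matrix_inv g')) ** g'
      = matrix_inv g ** (g ** matrix_inv g' ** A) ** g'"
    by simp
  then show ?L
    using assms by (simp add: conj_act_def matrix_mul_assoc [symmetric] invertible_conj_cancel matrix_inv_mult)
qed

lemma conj_act_eqI:
  assumes "invertible s" "A ** s = s ** B"
  shows "conj_act A s = B"
  by (metis assms conj_act_def invertible_conj_cancel(2) matrix_mul_assoc)

section \<open>Complex linear functionals and the invariance of \<open>\<omega>\<close>\<close>

text \<open>The property of the derivatives of holomorphic functions that lets them be expanded in
  matrix units with complex coefficients.\<close>

definition complex_linear :: "('n::finite cmat \<Rightarrow> complex) \<Rightarrow> bool" where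
  "complex_linear u \<longleftrightarrow> linear u \<and> (\<forall>c X. u (mat c ** X) = c * u X)"

lemma complex_linear_mult:
  fixes Y Z :: "'n::finite cmat"
  assumes "complex_linear u"
  shows "complex_linear (\<lambda>X :: 'n cmat. u (Y ** X ** Z))"
proof -
  have "linear (\<lambda>X :: 'n cmat. Y ** X ** Z)"
    by (intro linearI) (simp_all add: mmult.add_left mmult.add_right mmult.scaleR_left mmult.scaleR_right)
  then have "linear (\<lambda>X. u (Y ** X ** Z))"
    using assms linear_compose [of "\<lambda>X. Y ** X ** Z" u] by (simp add: complex_linear_def o_def)
  moreover have "Y ** (mat c ** X) ** Z = mat c ** (Y ** X ** Z)" for c X
    by (metis mat_mult_left_commute matrix_mul_assoc)
  ultimately show ?thesis
    using assms by (simp add: complex_linear_def)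
qed

lemma complex_linear_expand:
  assumes "complex_linear u"
  shows "u X = (\<Sum>i\<in>UNIV. \<Sum>j\<in>UNIV. X $ i $ j * u (munit i j))"
proof -
  have "(\<Sum>i\<in>UNIV. \<Sum>j\<in>UNIV. mat (X $ i $ j) ** munit i j) $ a $ b = X $ a $ b" for a b
  proof -
    have "(\<Sum>i\<in>UNIV. \<Sum>j\<in>UNIV. mat (X $ i $ j) ** munit i j) $ a $ b
        = (\<Sum>i\<in>UNIV. \<Sum>j\<in>UNIV. if b = j then if a = i then X $ i $ j else 0 else 0)"
      unfolding sum_component mat_mult_nth munit_nth by (intro sum.cong refl) auto
    then show ?thesis
      by simp
  qed
  then have "X = (\<Sum>i\<in>UNIV. \<Sum>j\<in>UNIV. mat (X $ i $ j) ** munit i j)"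
    by (simp add: vec_eq_iff)
  then have "u X = u (\<Sum>i\<in>UNIV. \<Sum>j\<in>UNIV. mat (X $ i $ j) ** munit i j)"
    by simp
  also have "\<dots> = (\<Sum>i\<in>UNIV. \<Sum>j\<in>UNIV. u (mat (X $ i $ j) ** munit i j))"
    using assms by (simp add: complex_linear_def linear_sum)
  finally show ?thesis
    using assms by (simp add: complex_linear_def)
qed

text \<open>Conjugation by \<open>g\<close> in the first factor of \<omega> can be traded for
  conjugation by its inverse in the second, because \<omega> is dual to the trace form; there it
  cancels the conjugation already present.\<close>

lemma omega_invariant:
  fixes g :: "'n::finite cmat"
  assumes u: "complex_linear u" and v: "complex_linear v" and g: "invertible g"
  shows "(\<Sum>i\<in>UNIV. \<Sum>j\<in>UNIV.
      u (matrix_inv g ** munit i j ** g) * v (matrix_inv g ** munit j i ** g))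
    = (\<Sum>i\<in>UNIV. \<Sum>j\<in>UNIV. u (munit i j) * v (munit j i))"
proof -
  define h where "h = matrix_inv g"
  \<comment> \<open>\<open>w\<close> hides the conjugation in the second factor until the one in the
    first factor has been moved over.\<close>
  define w where "w = (\<lambda>Y. v (h ** Y ** g))"
  have w: "complex_linear w"
    unfolding w_def by (rule complex_linear_mult [OF v])
  have "(\<Sum>i\<in>UNIV. \<Sum>j\<in>UNIV. u (h ** munit i j ** g) * w (munit j i))
      = (\<Sum>i\<in>UNIV. \<Sum>j\<in>UNIV. \<Sum>k\<in>UNIV. \<Sum>l\<in>UNIV.
          u (munit k l) * (g $ j $ l * h $ k $ i * w (munit j i)))"
    by (subst complex_linear_expand [OF u])
      (simp add: munit_conj_nth sum_distrib_left sum_distrib_right mult_ac)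
  \<comment> \<open>These exchanges bring the sums over \<open>j\<close> and \<open>i\<close>
    innermost, where they form the expansion of \<open>w (g ** munit l k ** h)\<close>.\<close>
  also have "\<dots> = (\<Sum>i\<in>UNIV. \<Sum>k\<in>UNIV. \<Sum>j\<in>UNIV. \<Sum>l\<in>UNIV.
          u (munit k l) * (g $ j $ l * h $ k $ i * w (munit j i)))"
    by (intro sum.cong refl sum.swap)
  also have "\<dots> = (\<Sum>k\<in>UNIV. \<Sum>i\<in>UNIV. \<Sum>j\<in>UNIV. \<Sum>l\<in>UNIV.
          u (munit k l) * (g $ j $ l * h $ k $ i * w (munit j i)))"
    by (rule sum.swap)
  also have "\<dots> = (\<Sum>k\<in>UNIV. \<Sum>i\<in>UNIV. \<Sum>l\<in>UNIV. \<Sum>j\<in>UNIV.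
          u (munit k l) * (g $ j $ l * h $ k $ i * w (munit j i)))"
    by (intro sum.cong refl sum.swap)
  also have "\<dots> = (\<Sum>k\<in>UNIV. \<Sum>l\<in>UNIV. \<Sum>i\<in>UNIV. \<Sum>j\<in>UNIV.
          u (munit k l) * (g $ j $ l * h $ k $ i * w (munit j i)))"
    by (intro sum.cong refl sum.swap)
  also have "\<dots> = (\<Sum>k\<in>UNIV. \<Sum>l\<in>UNIV. \<Sum>j\<in>UNIV. \<Sum>i\<in>UNIV.
          u (munit k l) * (g $ j $ l * h $ k $ i * w (munit j i)))"
    by (intro sum.cong refl sum.swap)
  also have "\<dots> = (\<Sum>k\<in>UNIV. \<Sum>l\<in>UNIV. u (munit k l) * w (g ** munit l k ** h))"
    by (subst (2) complex_linear_expand [OF w]) (simp add: munit_conj_nth sum_distrib_left)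
  also have "\<dots> = (\<Sum>k\<in>UNIV. \<Sum>l\<in>UNIV. u (munit k l) * v (munit l k))"
  proof -
    have "h ** (g ** Y ** h) ** g = Y" for Y
      using g by (simp add: h_def matrix_mul_assoc [symmetric] invertible_conj_cancel matrix_inv_mult)
    then show ?thesis
      by (simp add: w_def)
  qed
  finally show ?thesis
    by (simp add: w_def h_def)
qed

section \<open>Bidifferential operators\<close>

lemma tensor_munit_nth:
  "tensor (munit a b) (munit c d) $ q = (if q = (a, b, c, d) then 1 else 0)"
  by (cases q) (auto simp: tensor_def munit_nth)

text \<open>The coordinates of such a tensor sit in one place, so one term survives. Together with
  linearity in the tensor, proved next, this evaluates \<omega> and the quasi-root bivector.\<close>

lemma bidiff_tensor_munit:
  "bidiff (tensor (munit i j) (munit k l)) a b f h A = a (munit i j) f A * b (munit k l) h A"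
proof -
  have "bidiff (tensor (munit i j) (munit k l)) a b f h A
      = (\<Sum>q\<in>UNIV. if q = (i, j, k, l) then a (munit i j) f A * b (munit k l) h A else 0)"
    unfolding bidiff_def by (rule sum.cong) (auto simp: tensor_munit_nth split: if_splits)
  then show ?thesis
    by simp
qed

lemma bidiff_diff: "bidiff (\<psi> - \<theta>) a b f h A = bidiff \<psi> a b f h A - bidiff \<theta> a b f h A"
  unfolding bidiff_def sum_subtractf [symmetric]
  by (rule sum.cong) (auto simp: algebra_simps)

lemma bidiff_scale: "bidiff (c *s \<psi>) a b f h A = c * bidiff \<psi> a b f h A"
  unfolding bidiff_def sum_distrib_left
  by (rule sum.cong) (auto simp: mult_ac)

lemma bidiff_sum: "bidiff (\<Sum>x\<in>I. \<psi> x) a b f h A = (\<Sum>x\<in>I. bidiff (\<psi> x) a b f h A)"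
proof -
  have "bidiff (\<Sum>x\<in>I. \<psi> x) a b f h A = (\<Sum>q\<in>UNIV. \<Sum>x\<in>I. case q of (i, j, k, l) \<Rightarrow>
      \<psi> x $ (i, j, k, l) * (a (munit i j) f A * b (munit k l) h A))"
    unfolding bidiff_def by (rule sum.cong) (auto simp: sum_distrib_right)
  also have "\<dots> = (\<Sum>x\<in>I. bidiff (\<psi> x) a b f h A)"
    unfolding bidiff_def by (rule sum.swap)
  finally show ?thesis .
qed

lemma RE_invariant_part_eq:
  "RE_invariant_part f h A = (\<Sum>i\<in>UNIV. \<Sum>j\<in>UNIV.
     act_r (munit i j) f A * act_l (munit j i) h A - act_l (munit i j) f A * act_r (munit j i) h A)"
  by (simp add: RE_invariant_part_def omega_tensor_def bidiff_sum bidiff_tensor_munit sum_subtractf)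

section \<open>Differentiating along the orbit\<close>

text \<open>If \<open>X\<^sup>2 = s X\<close> then \<open>(1 + t X)\<^sup>-\<^sup>1 = 1 - t / (1 + t s) X\<close>, so the curve \<open>g (1 + t X)\<close> can be
  inverted explicitly.  This case is enough: all \<open>X\<close> that occur are conjugates of matrix units.\<close>

lemma frechet_derivative_conj_act:
  fixes g X D :: "'n::finite cmat" and s :: real
  assumes g: "invertible g" and X: "X ** X = s *\<^sub>R X"
    and U: "open U" "conj_act D g \<in> U"
    and f: "f differentiable (at (conj_act D g))" and F: "F differentiable (at g)"
    and eq: "\<And>g'. invertible g' \<Longrightarrow> conj_act D g' \<in> U \<Longrightarrow> f (conj_act D g') = F g'"
  shows "frechet_derivative f (at (conj_act D g)) (conj_act D g ** X - X ** conj_act D g)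
    = frechet_derivative F (at g) (g ** X)"
proof -
  define A where "A = conj_act D g"
  define r where "r = (\<lambda>t. t / (1 + t * s))"
  define \<gamma> where "\<gamma> = (\<lambda>t. g + t *\<^sub>R (g ** X))"
  \<comment> \<open>This is \<open>(mat 1 - r t *\<^sub>R X) ** A ** (mat 1 + t *\<^sub>R X)\<close>
    multiplied out, the orbit point of \<open>\<gamma> t\<close> as long as \<open>1 + t * s\<close>
    is nonzero.\<close>
  define \<delta> where "\<delta> = (\<lambda>t. A + t *\<^sub>R (A ** X) - r t *\<^sub>R (X ** A) - (r t * t) *\<^sub>R (X ** A ** X))"
  have r0: "r 0 = 0"
    by (simp add: r_def)
  have r: "(r has_real_derivative 1) (at 0)"
    unfolding r_def by (auto intro!: derivative_eq_intros)
  have \<gamma>: "(\<gamma> has_vector_derivative g ** X) (at 0)"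
    unfolding \<gamma>_def by (auto intro!: derivative_eq_intros simp: has_vector_derivative_def)
  have "((\<lambda>t. r t * t) has_real_derivative 0) (at 0)"
    using DERIV_mult [OF r DERIV_ident] by (simp add: r0)
  then have \<delta>: "(\<delta> has_vector_derivative A ** X - X ** A) (at 0)"
    unfolding \<delta>_def using r
    by (auto intro!: derivative_eq_intros
        simp: r0 has_real_derivative_iff_has_vector_derivative)
  have \<delta>0: "\<delta> 0 = A" and \<gamma>0: "\<gamma> 0 = g"
    by (simp_all add: \<delta>_def \<gamma>_def r0)
  have eq1: "\<gamma> t = g ** (mat 1 + t *\<^sub>R X)" for t
    by (simp add: \<gamma>_def mmult.add_right mmult.scaleR_right)
  have near: "f (\<delta> t) = F (\<gamma> t)" if t: "1 + t * s \<noteq> 0" "\<delta> t \<in> U" for t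
  proof -
    \<comment> \<open>The left side is the coefficient of \<open>X\<close> in both products below,
      once \<open>X ** X\<close> is replaced by \<open>s *\<^sub>R X\<close>.\<close>
    have c: "t - r t - r t * t * s = 0"
      using t(1) by (simp add: r_def field_simps)
    have "(mat 1 + t *\<^sub>R X) ** (mat 1 - r t *\<^sub>R X) = mat 1 + (t - r t - r t * t * s) *\<^sub>R X"
      "(mat 1 - r t *\<^sub>R X) ** (mat 1 + t *\<^sub>R X) = mat 1 + (t - r t - r t * t * s) *\<^sub>R X"
      by (simp_all add: mmult.add_right mmult.add_left mmult.diff_left mmult.diff_right
          mmult.scaleR_right mmult.scaleR_left X algebra_simps)
    then have inv: "(mat 1 + t *\<^sub>R X) ** (mat 1 - r t *\<^sub>R X) = mat 1"
      "(mat 1 - r t *\<^sub>R X) ** (mat 1 + t *\<^sub>R X) = mat 1"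
      by (simp_all only: c) simp_all
    have gi: "\<gamma> t ** ((mat 1 - r t *\<^sub>R X) ** matrix_inv g) = mat 1"
      "((mat 1 - r t *\<^sub>R X) ** matrix_inv g) ** \<gamma> t = mat 1"
      unfolding eq1 using inv matrix_inv_mult [OF g]
      by (metis matrix_mul_assoc matrix_mul_rid)+
    then have "invertible (\<gamma> t)"
      by (auto simp: invertible_def)
    have "conj_act D (\<gamma> t) = (mat 1 - r t *\<^sub>R X) ** A ** (mat 1 + t *\<^sub>R X)"
      unfolding conj_act_def matrix_inv_eqI [OF gi] A_def
      unfolding eq1 by (simp only: matrix_mul_assoc)
    also have "\<dots> = \<delta> t"
      by (simp add: \<delta>_def mmult.add_right mmult.add_left mmult.diff_left mmult.diff_right
          mmult.scaleR_right mmult.scaleR_left algebra_simps)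
    finally show ?thesis
      using eq [OF \<open>invertible (\<gamma> t)\<close>] t(2) by simp
  qed
  have "((\<lambda>t. 1 + t * s) \<longlongrightarrow> 1 + 0 * s) (at 0)"
    by (intro tendsto_intros)
  then have "\<forall>\<^sub>F t in at 0. 1 + t * s \<noteq> 0"
    by (rule tendsto_imp_eventually_ne) simp
  moreover have "(\<delta> \<longlongrightarrow> A) (at 0)"
    using has_vector_derivative_continuous [OF \<delta>] \<delta>0 by (simp add: continuous_at)
  then have "\<forall>\<^sub>F t in at 0. \<delta> t \<in> U"
    using U by (intro topological_tendstoD) (simp_all add: A_def)
  ultimately have ev: "\<forall>\<^sub>F t in at 0. (f \<circ> \<delta>) t = (F \<circ> \<gamma>) t"
    by eventually_elim (simp add: near)
  have 1: "((f \<circ> \<delta>) has_vector_derivative frechet_derivative f (at A) (A ** X - X ** A)) (at 0)"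
    using f vector_derivative_diff_chain_within [OF \<delta>, of f "frechet_derivative f (at A)"]
    by (simp add: A_def [symmetric] \<delta>0 frechet_derivative_works [symmetric] has_derivative_at_withinI)
  have 2: "((F \<circ> \<gamma>) has_vector_derivative frechet_derivative F (at g) (g ** X)) (at 0)"
    using F vector_derivative_diff_chain_within [OF \<gamma>, of F "frechet_derivative F (at g)"]
    by (simp add: \<gamma>0 frechet_derivative_works [symmetric] has_derivative_at_withinI)
  \<comment> \<open>The two curves of values agree near 0; \<open>ev\<close> says nothing about 0
    itself, which is supplied by \<open>near [of 0]\<close>.\<close>
  have "((f \<circ> \<delta>) has_vector_derivative frechet_derivative F (at g) (g ** X)) (at 0)"
    using 2 unfolding has_vector_derivative_def
    by (rule has_derivative_transform_eventually)
      (use ev near [of 0] \<delta>0 \<gamma>0 U in \<open>auto simp: A_def eq_commute elim: eventually_mono\<close>)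
  from vector_derivative_unique_at [OF 1 this] show ?thesis
    by (simp add: A_def)
qed

section \<open>A holomorphic local section of the orbit map\<close>

text \<open>Entire maps suffice here: the local section will be polynomial in the entries of its
  argument.\<close>

definition matrix_holomorphic :: "('n::finite cmat \<Rightarrow> 'n cmat) \<Rightarrow> bool" where
  "matrix_holomorphic T \<longleftrightarrow>
     (\<forall>A. \<exists>T'. (T has_derivative T') (at A) \<and> (\<forall>c X. T' (mat c ** X) = mat c ** T' X))"

lemma matrix_holomorphic_const: "matrix_holomorphic (\<lambda>_. C)"
  unfolding matrix_holomorphic_def by (intro allI exI [of _ "\<lambda>_. 0"]) auto

lemma matrix_holomorphic_ident: "matrix_holomorphic (\<lambda>A. A)"
  unfolding matrix_holomorphic_def by (intro allI exI [of _ "\<lambda>X. X"]) auto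

lemma matrix_holomorphic_diff:
  assumes "matrix_holomorphic T" "matrix_holomorphic S"
  shows "matrix_holomorphic (\<lambda>A. T A - S A)"
  unfolding matrix_holomorphic_def
proof
  fix A
  from assms obtain T' S' where "(T has_derivative T') (at A)" "\<And>c X. T' (mat c ** X) = mat c ** T' X"
    "(S has_derivative S') (at A)" "\<And>c X. S' (mat c ** X) = mat c ** S' X"
    unfolding matrix_holomorphic_def by metis
  then show "\<exists>R. ((\<lambda>A. T A - S A) has_derivative R) (at A) \<and> (\<forall>c X. R (mat c ** X) = mat c ** R X)"
    by (intro exI [of _ "\<lambda>X. T' X - S' X"]) (auto intro!: derivative_intros simp: mmult.diff_right)
qed

lemma matrix_holomorphic_mult:
  assumes "matrix_holomorphic T" "matrix_holomorphic S"
  shows "matrix_holomorphic (\<lambda>A. T A ** S A)"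
  unfolding matrix_holomorphic_def
proof
  fix A
  from assms obtain T' S' where TS: "(T has_derivative T') (at A)" "\<And>c X. T' (mat c ** X) = mat c ** T' X"
    "(S has_derivative S') (at A)" "\<And>c X. S' (mat c ** X) = mat c ** S' X"
    unfolding matrix_holomorphic_def by metis
  have "(mat c ** Y) ** Z = mat c ** (Y ** Z)" for c :: complex and Y Z :: "'a cmat"
    by (simp add: matrix_mul_assoc)
  with TS show "\<exists>R. ((\<lambda>A. T A ** S A) has_derivative R) (at A) \<and> (\<forall>c X. R (mat c ** X) = mat c ** R X)"
    by (intro exI [of _ "\<lambda>X. T A ** S' X + T' X ** S A"])
      (auto intro!: mmult.FDERIV simp: mmult.add_right mat_mult_left_commute)
qed

lemma matrix_holomorphic_sum:
  assumes "finite I" "\<And>i. i \<in> I \<Longrightarrow> matrix_holomorphic (T i)"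
  shows "matrix_holomorphic (\<lambda>A. \<Sum>i\<in>I. T i A)"
  using assms
proof (induction I)
  case empty
  then show ?case
    by (simp add: matrix_holomorphic_const)
next
  case (insert i I)
  \<comment> \<open>A sum is written as a difference from a negative, so that closure under
    differences is enough.\<close>
  then have "matrix_holomorphic (\<lambda>A. T i A - (0 - (\<Sum>i\<in>I. T i A)))"
    by (intro matrix_holomorphic_diff matrix_holomorphic_const) auto
  with insert show ?case
    by simp
qed

lemma matrix_holomorphic_continuous:
  assumes "matrix_holomorphic T"
  shows "continuous_on UNIV T"
proof (rule continuous_at_imp_continuous_on, safe)
  fix A
  from assms obtain T' where "(T has_derivative T') (at A)"
    unfolding matrix_holomorphic_def by metis
  then show "isCont T A"
    by (rule has_derivative_continuous)
qed

lemma mholomorphic_on_compose: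
  assumes F: "mholomorphic_on F V" and S: "matrix_holomorphic S"
  shows "mholomorphic_on (F \<circ> S) (S -` V)"
  unfolding mholomorphic_on_def
proof safe
  show "open (S -` V)"
    using F matrix_holomorphic_continuous [OF S]
    by (auto simp: mholomorphic_on_def intro: open_vimage)
  fix A assume A: "S A \<in> V"
  from S obtain S' where S': "(S has_derivative S') (at A)" "\<And>c X. S' (mat c ** X) = mat c ** S' X"
    unfolding matrix_holomorphic_def by metis
  have d: "(F has_derivative frechet_derivative F (at (S A))) (at (S A))"
    using F A by (simp add: mholomorphic_on_def frechet_derivative_works [symmetric])
  have D: "((F \<circ> S) has_derivative (frechet_derivative F (at (S A)) \<circ> S')) (at A)"
    using S'(1) d by (rule diff_chain_at)
  then show "(F \<circ> S) differentiable (at A)"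
    by (rule differentiableI)
  fix c X
  show "frechet_derivative (F \<circ> S) (at A) (mat c ** X) = c * frechet_derivative (F \<circ> S) (at A) X"
    using F A S'(2) frechet_derivative_at [OF D, symmetric] by (simp add: mholomorphic_on_def)
qed

text \<open>At a diagonalizable matrix whose eigenvalues are \<open>\<mu>\<close> and the members of the list, this is the
  spectral projector of the eigenvalue \<open>\<mu>\<close>.\<close>

fun lagrange :: "'n::finite cmat \<Rightarrow> complex \<Rightarrow> complex list \<Rightarrow> 'n cmat" where
  "lagrange A \<mu> [] = mat 1"
| "lagrange A \<mu> (\<nu> # \<nu>s) = mat (1 / (\<mu> - \<nu>)) ** (A - mat \<nu>) ** lagrange A \<mu> \<nu>s"

lemma matrix_holomorphic_lagrange: "matrix_holomorphic (\<lambda>A. lagrange A \<mu> \<nu>s)"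
  by (induction \<nu>s)
    (auto intro!: matrix_holomorphic_mult matrix_holomorphic_diff
      matrix_holomorphic_const matrix_holomorphic_ident)

lemma conj_act_mult:
  assumes "invertible g"
  shows "conj_act (X ** Y) g = conj_act X g ** conj_act Y g"
  using assms by (simp add: conj_act_def matrix_mul_assoc [symmetric] invertible_conj_cancel)

lemma conj_act_mat:
  assumes "invertible g"
  shows "conj_act (mat c) g = mat c"
  using assms
  by (metis conj_act_def invertible_conj_cancel(4) mat_mult_commute)

lemma conj_act_diff: "conj_act (X - Y) g = conj_act X g - conj_act Y g"
  by (simp add: conj_act_def mmult.diff_left mmult.diff_right)

text \<open>\<open>lagrange\<close> is a polynomial in its matrix argument, and conjugation respects
  products and differences and fixes scalar matrices.\<close>

lemma lagrange_conj_act: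
  assumes "invertible g"
  shows "lagrange (conj_act A g) \<mu> \<nu>s = conj_act (lagrange A \<mu> \<nu>s) g"
  using assms by (induction \<nu>s) (simp_all add: conj_act_mult conj_act_mat conj_act_diff)

lemma lagrange_diag:
  "lagrange (diag d) \<mu> \<nu>s = diag (\<lambda>a. \<Prod>\<nu>\<leftarrow>\<nu>s. (d a - \<nu>) / (\<mu> - \<nu>))"
  by (induction \<nu>s) (simp_all add: mat_eq_diag diag_minus_diag diag_mult_diag)

text \<open>The rows of \<open>g\<close> are left eigenvectors of \<open>g\<^sup>-\<^sup>1 D g\<close>.  Projecting them to the eigenspaces of a
  neighbouring matrix of the orbit gives left eigenvectors of that matrix.\<close>

lemma local_section:
  fixes d :: "'n::finite \<Rightarrow> complex" and g :: "'n cmat"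
  assumes g: "invertible g"
  obtains S where "matrix_holomorphic S" "S (conj_act (diag d) g) = g"
    "\<And>g'. invertible g' \<Longrightarrow>
      diag d ** S (conj_act (diag d) g') = S (conj_act (diag d) g') ** conj_act (diag d) g'"
proof -
  define D where "D = diag d"
  \<comment> \<open>A list of the eigenvalues other than \<mu>, as nodes for the interpolation
    polynomial.\<close>
  have "\<forall>\<mu>. \<exists>\<nu>s. set \<nu>s = range d - {\<mu>}"
    by (simp add: finite_list)
  then obtain \<nu>s where \<nu>s: "\<And>\<mu>. set (\<nu>s \<mu>) = range d - {\<mu>}"
    by metis
  define p where "p = (\<lambda>a (A :: 'n cmat). lagrange A (d a) (\<nu>s (d a)))"
  \<comment> \<open>Summand \<open>a\<close> is row \<open>a\<close> of \<open>g\<close> times the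
    spectral projector for \<open>d a\<close>, placed in row \<open>a\<close>.\<close>
  define S where "S = (\<lambda>A. \<Sum>a\<in>UNIV. munit a a ** g ** p a A)"
  have pD: "p a D = diag (\<lambda>b. if d b = d a then 1 else 0)" for a
  proof -
    \<comment> \<open>If \<open>d b = d a\<close>, each factor is 1; otherwise \<open>d b\<close> is
      one of the nodes and its factor is 0.\<close>
    have "(\<Prod>\<nu>\<leftarrow>\<nu>s (d a). (d b - \<nu>) / (d a - \<nu>)) = (if d b = d a then 1 else 0)" for b
    proof (cases "d b = d a")
      case True
      have "(d b - \<nu>) / (d a - \<nu>) = 1" if "\<nu> \<in> set (\<nu>s (d a))" for \<nu>
      proof -
        have "\<nu> \<noteq> d a"
          using that \<nu>s by blast
        then show ?thesis
          using True by simp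
      qed
      then have "map (\<lambda>\<nu>. (d b - \<nu>) / (d a - \<nu>)) (\<nu>s (d a)) = map (\<lambda>_. 1) (\<nu>s (d a))"
        by simp
      then show ?thesis
        using True by (simp add: map_replicate_const)
    next
      case False
      then have "d b \<in> set (\<nu>s (d a))"
        using \<nu>s by blast
      then have "0 \<in> set (map (\<lambda>\<nu>. (d b - \<nu>) / (d a - \<nu>)) (\<nu>s (d a)))"
        by (metis (no_types, lifting) diff_self div_0 image_eqI list.set_map)
      then show ?thesis
        using False by (simp only: prod_list_zero_iff if_False)
    qed
    then show ?thesis
      by (simp add: p_def D_def lagrange_diag)
  qed
  have p_conj: "p a (conj_act D g') = conj_act (p a D) g'" if "invertible g'" for a g'
    using that by (simp add: p_def lagrange_conj_act)
  \<comment> \<open>An identity of diagonal matrices; conjugating it gives the eigenvalue equation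
    on the whole orbit.\<close>
  have "p a D ** D = mat (d a) ** p a D" for a
    unfolding pD
    unfolding D_def diag_mult_diag mat_eq_diag by (rule arg_cong [where f = diag]) auto
  then have p_mult: "p a (conj_act D g') ** conj_act D g' = mat (d a) ** p a (conj_act D g')"
    if "invertible g'" for a g'
    using that by (metis conj_act_mat conj_act_mult p_conj)
  show thesis
  proof
    show "matrix_holomorphic S"
      unfolding S_def p_def
      by (intro matrix_holomorphic_sum matrix_holomorphic_mult matrix_holomorphic_const
          matrix_holomorphic_lagrange) auto
    \<comment> \<open>At the orbit point of \<open>g\<close> itself the projector fixes row
      \<open>a\<close> of \<open>g\<close>, so \<open>S\<close> returns \<open>g\<close>.\<close>
    have "munit a a ** g ** p a (conj_act D g) = munit a a ** g" for a
    proof -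
      have "munit a a ** g ** p a (conj_act D g) = munit a a ** (p a D) ** g"
        unfolding p_conj [OF g] unfolding conj_act_def
        using g by (simp add: matrix_mul_assoc [symmetric] invertible_conj_cancel)
      also have "\<dots> = munit a a ** g"
        by (simp add: pD munit_mult_diag)
      finally show ?thesis .
    qed
    then have "S (conj_act D g) = (\<Sum>a\<in>UNIV. munit a a) ** g"
      by (simp add: S_def mmult.sum_left)
    then show "S (conj_act (diag d) g) = g"
      by (simp add: sum_munit_diag D_def)
    fix g' :: "'n cmat" assume g': "invertible g'"
    have "D ** (munit a a ** g ** p a (conj_act D g')) = munit a a ** g ** p a (conj_act D g') ** conj_act D g'"
      for a
    proof -
      have "D ** (munit a a ** g ** p a (conj_act D g')) = (D ** munit a a) ** (g ** p a (conj_act D g'))"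
        by (simp only: matrix_mul_assoc)
      also have "\<dots> = munit a a ** g ** (mat (d a) ** p a (conj_act D g'))"
        by (simp only: D_def diag_mult_munit mat_mult_left_commute) (simp only: matrix_mul_assoc)
      also have "\<dots> = munit a a ** g ** p a (conj_act D g') ** conj_act D g'"
        by (simp only: p_mult [OF g', symmetric] matrix_mul_assoc)
      finally show ?thesis .
    qed
    then show "diag d ** S (conj_act (diag d) g') = S (conj_act (diag d) g') ** conj_act (diag d) g'"
      by (simp add: S_def D_def mmult.sum_left mmult.sum_right)
  qed
qed

section \<open>The homogeneous space\<close>

text \<open>The index function \<open>bi\<close> replaces the position counts in
  \<open>block\<close>: it names the block of each basis vector and so expresses that the blocks
  partition the basis.\<close>

locale block_decomposition =
  fixes ns :: "nat \<Rightarrow> nat" and k :: nat and ev :: "nat \<Rightarrow> complex"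
    and bi :: "'n::{finite,linorder} \<Rightarrow> nat"
  assumes bi_range: "bi a \<in> {1..k}"
    and block_iff: "i \<in> {1..k} \<Longrightarrow> a \<in> block ns i \<longleftrightarrow> bi a = i"
    and inj_ev: "inj_on ev {1..k}"
begin

definition d :: "'n \<Rightarrow> complex" where
  "d a = ev (bi a)"

abbreviation D :: "'n cmat" where
  "D \<equiv> diag d"

lemma d_eq_iff: "d a = d b \<longleftrightarrow> bi a = bi b"
  using inj_onD [OF inj_ev _ bi_range bi_range] by (auto simp: d_def)

lemma base_point_eq: "base_point ns k ev = D"
proof -
  have "base_point ns k ev $ a $ b = D $ a $ b" for a b
  proof -
    have "base_point ns k ev $ a $ b = (\<Sum>i\<in>{1..k}. if bi a = i then if a = b then ev i else 0 else 0)"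
      unfolding base_point_def sum_component mat_mult_nth block_proj_def
      by (intro sum.cong refl) (auto simp: block_iff)
    also have "\<dots> = (if a = b then d a else 0)"
      using bi_range [of a] by (simp add: d_def)
    finally show ?thesis
      by (simp add: diag_def)
  qed
  then show ?thesis
    by (simp add: vec_eq_iff)
qed

text \<open>Entry \<open>(a, b)\<close> of the commutator with \<open>D\<close> is
  \<open>d a - d b\<close> times that of \<open>g\<close>, and distinct blocks have distinct
  eigenvalues. Thus the Levi subgroup is the stabilizer of the base point.\<close>

lemma levi_eq: "levi ns k = {g. invertible g \<and> D ** g = g ** D}"
proof -
  have same_block: "(\<exists>i. i \<in> {1..k} \<and> a \<in> block ns i \<and> b \<in> block ns i) \<longleftrightarrow> d a = d b" for a b
    using bi_range block_iff by (metis d_eq_iff)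
  have "D ** g = g ** D \<longleftrightarrow> (\<forall>a b. d a \<noteq> d b \<longrightarrow> g $ a $ b = 0)" for g
    unfolding vec_eq_iff diag_mult_nth mult_diag_nth by (auto simp: mult.commute)
  then show ?thesis
    by (simp only: levi_def GL_def same_block) simp
qed

text \<open>Since the Levi subgroup is the stabilizer, cosets are exactly the fibres of the orbit
  map.\<close>

lemma quot_map_eq:
  assumes g: "invertible g"
  shows "quot_map ns k g = {g'. invertible g' \<and> conj_act D g' = conj_act D g}"
proof -
  have "quot_map ns k g = (\<lambda>h. h ** g) ` levi ns k"
    by (auto simp: quot_map_def r_coset_def GL_def)
  moreover have "g' \<in> (\<lambda>h. h ** g) ` levi ns k
      \<longleftrightarrow> invertible g' \<and> conj_act D g' = conj_act D g" for g'
  proof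
    assume "g' \<in> (\<lambda>h. h ** g) ` levi ns k"
    then obtain h where h: "invertible h" "D ** h = h ** D" and g': "g' = h ** g"
      by (auto simp: levi_eq)
    have "invertible g'"
      using h g g' by (simp add: invertible_mult)
    moreover have "g' ** matrix_inv g = h"
      using g by (simp add: g' invertible_conj_cancel)
    ultimately show "invertible g' \<and> conj_act D g' = conj_act D g"
      using g h by (simp add: conj_act_eq_iff)
  next
    assume g': "invertible g' \<and> conj_act D g' = conj_act D g"
    then have "D ** (g' ** matrix_inv g) = g' ** matrix_inv g ** D"
      using conj_act_eq_iff [of g' g D] g by blast
    then have "g' ** matrix_inv g \<in> levi ns k"
      using g g' by (simp add: levi_eq invertible_mult invertible_matrix_inv)
    moreover have "g' = g' ** matrix_inv g ** g"
      using g by (simp add: invertible_conj_cancel)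
    ultimately show "g' \<in> (\<lambda>h. h ** g) ` levi ns k"
      by blast
  qed
  ultimately show ?thesis
    by blast
qed

lemma quot_map_eq_iff:
  fixes g g' :: "'n cmat"
  assumes "invertible g" "invertible g'"
  shows "quot_map ns k g = quot_map ns k g' \<longleftrightarrow> conj_act D g = conj_act D g'"
  using assms by (auto simp: quot_map_eq)

lemma homog_eq: "homog ns k = quot_map ns k ` {g :: 'n cmat. invertible g}"
  by (auto simp: homog_def RCOSETS_def quot_map_def GL_def)

lemma homog_memberD:
  fixes x :: "'n cmat set"
  assumes "x \<in> homog ns k" "g \<in> x"
  shows "invertible g" "x = quot_map ns k g"
proof -
  obtain h where "invertible h" "x = quot_map ns k h"
    using assms(1) by (auto simp: homog_eq)
  with assms(2) show "invertible g" "x = quot_map ns k g"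
    by (simp_all add: quot_map_eq)
qed

lemma homog_representative:
  fixes x :: "'n cmat set"
  assumes "x \<in> homog ns k"
  obtains g where "g \<in> x" "invertible g" "x = quot_map ns k g"
proof -
  obtain g where "invertible g" "x = quot_map ns k g"
    using assms by (auto simp: homog_eq)
  moreover from this have "g \<in> x"
    by (simp add: quot_map_eq)
  ultimately show thesis
    using that by blast
qed

lemma realize_quot_map:
  assumes "invertible g"
  shows "realize ns k ev (quot_map ns k g) = conj_act D g"
proof -
  have "conj_act D ` quot_map ns k g = {conj_act D g}"
    using assms by (auto simp: quot_map_eq)
  then show ?thesis
    by (simp add: realize_def base_point_eq)
qed

lemma bij_betw_realize: "bij_betw (realize ns k ev) (homog ns k) (orbit ns k ev :: 'n cmat set)"
proof -
  have "orbit ns k ev = conj_act D ` {g. invertible g}"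
    by (simp add: orbit_def base_point_eq GL_def)
  moreover have "inj_on (realize ns k ev) (homog ns k :: 'n cmat set set)"
    by (auto simp: inj_on_def homog_eq realize_quot_map quot_map_eq_iff)
  moreover have "realize ns k ev ` (homog ns k :: 'n cmat set set) = conj_act D ` {g. invertible g}"
    by (auto simp: homog_eq realize_quot_map image_image)
  ultimately show ?thesis
    by (simp add: bij_betw_def)
qed

section \<open>Local extensions\<close>

text \<open>Compose \<phi> with the quotient map and a local section \<open>S\<close> through a
  representative. At an orbit point near that of \<open>x\<close>, \<open>S\<close> picks a
  representative of the matching coset, so the composite agrees with \<phi> there.\<close>

lemma local_extension_exists:
  fixes x :: "'n cmat set"
  assumes x: "x \<in> homog ns k" and \<phi>: "holomorphic_near ns k \<phi> x"
  shows "\<exists>f. local_extension ns k ev f \<phi> x"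
proof -
  obtain g where g: "g \<in> x" "invertible g" "x = quot_map ns k g"
    using x by (rule homog_representative)
  obtain V where V: "g \<in> V" "V \<subseteq> {g. invertible g}" "mholomorphic_on (\<phi> \<circ> quot_map ns k) V"
    using \<phi> g(1) unfolding holomorphic_near_def GL_def by auto
  obtain S where S: "matrix_holomorphic S" "S (conj_act D g) = g"
    "\<And>g'. invertible g' \<Longrightarrow> D ** S (conj_act D g') = S (conj_act D g') ** conj_act D g'"
    using local_section [OF g(2), of d] by blast
  have "local_extension ns k ev (\<phi> \<circ> quot_map ns k \<circ> S) \<phi> x"
    unfolding local_extension_def
  proof (intro exI [of _ "S -` V"] conjI ballI impI)
    show "realize ns k ev x \<in> S -` V"
      using g V S(2) by (simp add: realize_quot_map)
    show "mholomorphic_on (\<phi> \<circ> quot_map ns k \<circ> S) (S -` V)"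
      using V(3) S(1) by (rule mholomorphic_on_compose)
    fix y assume y: "y \<in> homog ns k" "realize ns k ev y \<in> S -` V"
    then obtain g' where g': "invertible g'" "y = quot_map ns k g'"
      by (auto simp: homog_eq)
    then have V': "S (conj_act D g') \<in> V"
      using y by (simp add: realize_quot_map)
    \<comment> \<open>Invertibility comes from \<open>V\<close> lying in the group; it turns the
      intertwining property of \<open>S\<close> into equality of orbit points.\<close>
    then have "invertible (S (conj_act D g'))"
      using V(2) by auto
    moreover from this have "conj_act D (S (conj_act D g')) = conj_act D g'"
      using S(3) g'(1) by (intro conj_act_eqI)
    ultimately have "quot_map ns k (S (conj_act D g')) = y"
      using g' by (simp add: quot_map_eq_iff)
    then show "(\<phi> \<circ> quot_map ns k \<circ> S) (realize ns k ev y) = \<phi> y"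
      using g' by (simp add: realize_quot_map)
  qed
  then show ?thesis
    by blast
qed

lemma holomorphic_near_differentiable:
  fixes x :: "'n cmat set"
  assumes "holomorphic_near ns k \<phi> x" "g \<in> x"
  shows "(\<phi> \<circ> quot_map ns k) differentiable (at g)"
  using assms unfolding holomorphic_near_def mholomorphic_on_def by blast

text \<open>Along vectors tangent to the orbit, the derivative of an extension is fixed by \<phi>.
  The independence of the restricted brackets from the extensions rests on this.\<close>

lemma local_extension_derivative:
  assumes f: "local_extension ns k ev f \<phi> x" and \<phi>: "holomorphic_near ns k \<phi> x"
    and x: "x \<in> homog ns k" "g \<in> x" and X: "X ** X = s *\<^sub>R X"
  shows "act_ad X f (conj_act D g) = act_l X (\<phi> \<circ> quot_map ns k) g"
    and "complex_linear (frechet_derivative f (at (conj_act D g)))"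
proof -
  note g = homog_memberD [OF x]
  have A: "realize ns k ev x = conj_act D g"
    using g by (simp add: realize_quot_map)
  obtain U where U: "conj_act D g \<in> U" "mholomorphic_on f U"
    "\<And>y. y \<in> homog ns k \<Longrightarrow> realize ns k ev y \<in> U \<Longrightarrow> f (realize ns k ev y) = \<phi> y"
    using f unfolding local_extension_def A by blast
  have diff: "f differentiable (at (conj_act D g))"
    using U by (simp add: mholomorphic_on_def)
  then show "complex_linear (frechet_derivative f (at (conj_act D g)))"
    using U by (simp add: mholomorphic_on_def complex_linear_def linear_frechet_derivative)
  have "frechet_derivative f (at (conj_act D g)) (conj_act D g ** X - X ** conj_act D g)
      = frechet_derivative (\<phi> \<circ> quot_map ns k) (at g) (g ** X)"
  proof (rule frechet_derivative_conj_act [OF g(1) X _ U(1) diff])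
    show "open U"
      using U by (simp add: mholomorphic_on_def)
    show "(\<phi> \<circ> quot_map ns k) differentiable (at g)"
      using \<phi> x(2) by (rule holomorphic_near_differentiable)
    show "f (conj_act D g') = (\<phi> \<circ> quot_map ns k) g'"
      if "invertible g'" "conj_act D g' \<in> U" for g'
      using U(3) [of "quot_map ns k g'"] that by (simp add: homog_eq realize_quot_map)
  qed
  then show "act_ad X f (conj_act D g) = act_l X (\<phi> \<circ> quot_map ns k) g"
    by (simp add: act_ad_def act_l_def act_r_def linear_diff [OF linear_frechet_derivative [OF diff]])
qed

end

section \<open>Quasi-roots\<close>

text \<open>The diagonal entries 1 and -1 recover the two indices; hence \<open>root_vector\<close>
  is well defined.\<close>

lemma root_eq_iff:
  assumes "a \<noteq> b" "c \<noteq> e"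
  shows "munit a a - munit b b = munit c c - munit e e \<longleftrightarrow> a = c \<and> b = e"
proof
  assume eq: "munit a a - munit b b = munit c c - munit e e"
  have "(munit a a - munit b b) $ a $ a = (munit c c - munit e e) $ a $ a"
    "(munit a a - munit b b) $ b $ b = (munit c c - munit e e) $ b $ b"
    by (simp_all only: eq)
  then show "a = c \<and> b = e"
    using assms by (auto simp: munit_nth split: if_splits)
qed auto

lemma root_vector_eq:
  assumes "a \<noteq> b"
  shows "root_vector (munit a a - munit b b) = munit a b"
    "root_vector (- (munit a a - munit b b)) = munit b a"
proof -
  have *: "root_vector (munit a a - munit b b) = munit a b" if "a \<noteq> b" for a b :: 'a
    unfolding root_vector_def using that by (intro the_equality) (auto simp: root_eq_iff)
  show "root_vector (munit a a - munit b b) = munit a b"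
    using assms by (rule *)
  show "root_vector (- (munit a a - munit b b)) = munit b a"
    using * [of b a] assms by simp
qed

lemma munit_mult_block_proj: "munit a a ** block_proj ns i = munit a a \<longleftrightarrow> a \<in> block ns i"
  for a :: "'n::{finite,linorder}"
proof -
  have "block_proj ns i = (diag :: ('n \<Rightarrow> complex) \<Rightarrow> _) (\<lambda>b. if b \<in> block ns i then 1 else 0)"
    by (auto simp: block_proj_def diag_def vec_eq_iff)
  then have "munit a a ** block_proj ns i = mat (if a \<in> block ns i then 1 else 0) ** munit a a"
    by (simp only: munit_mult_diag)
  then show ?thesis
    by (auto simp: vec_eq_iff mat_mult_nth munit_nth split: if_splits)
qed

lemma quasi_root_eq:
  assumes "block ns i \<inter> block ns j = ({} :: 'n::{finite,linorder} set)"
  shows "quasi_root ns i j = (\<lambda>(a, b :: 'n). munit a a - munit b b) ` (block ns i \<times> block ns j)"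
  using assms unfolding quasi_root_def roots_def munit_mult_block_proj by (auto simp: image_iff) blast+

text \<open>Reindexes by pairs of basis vectors, which determine their roots injectively. With
  \<open>T\<close> arbitrary, both terms of the antisymmetric tensor are handled together.\<close>

lemma sum_quasi_root:
  fixes T :: "'n::{finite,linorder} cmat \<Rightarrow> 'n cmat \<Rightarrow> 'a::comm_monoid_add"
  assumes "block ns i \<inter> block ns j = ({} :: 'n set)"
  shows "(\<Sum>\<alpha>\<in>quasi_root ns i j. T (root_vector \<alpha>) (root_vector (- \<alpha>)))
    = (\<Sum>a\<in>block ns i. \<Sum>b\<in>block ns j. T (munit a b) (munit b a))"
proof -
  have ne: "a \<noteq> b" if "a \<in> block ns i" "b \<in> block ns j" for a b :: 'n
    using that assms by blast
  have "inj_on (\<lambda>(a, b :: 'n). munit a a - munit b b) (block ns i \<times> block ns j)"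
    by (auto simp: inj_on_def root_eq_iff ne)
  then have "(\<Sum>\<alpha>\<in>quasi_root ns i j. T (root_vector \<alpha>) (root_vector (- \<alpha>)))
      = (\<Sum>(a, b)\<in>block ns i \<times> block ns j. T (munit a b) (munit b a))"
    unfolding quasi_root_eq [OF assms]
    by (subst sum.reindex) (auto simp: root_vector_eq ne simp del: minus_diff_eq intro!: sum.cong)
  then show ?thesis
    by (simp add: sum.cartesian_product)
qed

section \<open>The restricted brackets\<close>

lemma sum_pairs_upper:
  fixes T :: "nat \<Rightarrow> nat \<Rightarrow> 'a::comm_monoid_add"
  assumes "\<And>i. T i i = 0"
  shows "(\<Sum>i\<in>{1..k}. \<Sum>j\<in>{1..k}. T i j) = (\<Sum>(i, j)\<in>{(i, j). 1 \<le> i \<and> i < j \<and> j \<le> k}. T i j + T j i)"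
proof -
  define P Q R where "P = {(i, j). 1 \<le> i \<and> i < j \<and> j \<le> k}"
    and "Q = {(i, j). 1 \<le> j \<and> j < i \<and> i \<le> k}" and "R = (\<lambda>i. (i, i)) ` {1..k}"
  have fin: "finite P" "finite Q" "finite R"
    by (rule finite_subset [of _ "{1..k} \<times> {1..k}"], auto simp: P_def Q_def R_def)+
  have "{1..k} \<times> {1..k} = P \<union> Q \<union> R"
    by (auto simp: P_def Q_def R_def image_iff)
  moreover have "P \<inter> Q = {}" "(P \<union> Q) \<inter> R = {}"
    by (auto simp: P_def Q_def R_def)
  moreover have "sum (\<lambda>(i, j). T i j) R = 0"
    using assms by (intro sum.neutral) (auto simp: R_def)
  ultimately have "(\<Sum>(i, j)\<in>{1..k} \<times> {1..k}. T i j) = (\<Sum>(i, j)\<in>P. T i j) + (\<Sum>(i, j)\<in>Q. T i j)"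
    using fin by (simp add: sum.union_disjoint)
  moreover have "(\<Sum>(i, j)\<in>Q. T i j) = (\<Sum>(i, j)\<in>P. T j i)"
    by (rule sum.reindex_bij_witness [of _ "\<lambda>(i, j). (j, i)" "\<lambda>(i, j). (j, i)"])
      (auto simp: P_def Q_def)
  ultimately show ?thesis
    by (simp add: sum.cartesian_product P_def sum.distrib [symmetric] case_prod_unfold)
qed

context block_decomposition
begin

lemma block_disjoint:
  assumes "i \<in> {1..k}" "j \<in> {1..k}" "i \<noteq> j"
  shows "block ns i \<inter> (block ns j :: 'n set) = {}"
  using assms by (auto simp: block_iff)

lemma sum_blocks: "(\<Sum>a\<in>UNIV. q a) = (\<Sum>i\<in>{1..k}. \<Sum>a\<in>block ns i. q (a :: 'n))"
proof -
  have "(UNIV :: 'n set) = (\<Union>i\<in>{1..k}. block ns i)"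
    using bi_range block_iff by blast
  then have "(\<Sum>a\<in>UNIV. q a) = sum q (\<Union>i\<in>{1..k}. block ns i)"
    by simp
  also have "\<dots> = (\<Sum>i\<in>{1..k}. \<Sum>a\<in>block ns i. q a)"
    using block_disjoint by (intro sum.UNION_disjoint) auto
  finally show ?thesis .
qed

lemma d_block: "i \<in> {1..k} \<Longrightarrow> a \<in> block ns i \<Longrightarrow> d a = ev i"
  using block_iff by (auto simp: d_def)

section \<open>Both bivectors in the conjugated matrix units\<close>

lemma conj_act_commutation:
  fixes g :: "'n cmat"
  assumes g: "invertible g"
  shows "conj_act D g ** conj_act (munit i j) g = mat (d i) ** conj_act (munit i j) g"
    "conj_act (munit i j) g ** conj_act D g = mat (d j) ** conj_act (munit i j) g"
  by (simp_all add: conj_act_mult [OF g, symmetric] diag_mult_munit munit_mult_diag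
      conj_act_mult [OF g] conj_act_mat [OF g])

text \<open>Moving \<open>g\<close> along \<open>munit i j ** g\<close> moves its orbit point
  \<open>A\<close> along the commutator of \<open>A\<close> with the conjugated unit, and that unit
  is an eigenvector of the commutator map.\<close>

lemma act_r_pullback:
  assumes f: "local_extension ns k ev f \<phi> x" and \<phi>: "holomorphic_near ns k \<phi> x"
    and x: "x \<in> homog ns k" "g \<in> x"
  shows "act_r (munit i j) (\<phi> \<circ> quot_map ns k) g
    = (d i - d j) * frechet_derivative f (at (conj_act D g)) (conj_act (munit i j) g)"
proof -
  have g: "invertible g"
    using x by (rule homog_memberD)
  define X where "X = conj_act (munit i j) g"
  \<comment> \<open>Conjugated units are idempotent or square to zero, so the explicit curve
    computation applies.\<close>
  have "X ** X = (if i = j then 1 else 0 :: real) *\<^sub>R X"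
    by (simp add: X_def conj_act_mult [OF g, symmetric] munit_mult_munit) (simp add: conj_act_def)
  note * = local_extension_derivative [OF f \<phi> x this]
  have "munit i j ** g = g ** X"
    using g by (simp add: X_def conj_act_def matrix_mul_assoc [symmetric] invertible_conj_cancel)
  then have "act_r (munit i j) (\<phi> \<circ> quot_map ns k) g = act_ad X f (conj_act D g)"
    by (simp add: * act_r_def act_l_def)
  also have "\<dots> = (d i - d j) * frechet_derivative f (at (conj_act D g)) X"
    using *(2) conj_act_commutation [OF g, of i j]
    by (simp add: act_ad_def act_l_def act_r_def X_def complex_linear_def left_diff_distrib)
  finally show ?thesis
    by (simp add: X_def)
qed

text \<open>After \<omega> is rewritten in conjugated units, multiplication by \<open>A\<close>
  contributes \<open>d b\<close> twice to the first sum and \<open>d a\<close> twice to the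
  second.\<close>

lemma RE_invariant_part_conj_act:
  fixes g :: "'n cmat"
  assumes g: "invertible g"
    and u: "complex_linear (frechet_derivative f (at (conj_act D g)))" (is "complex_linear ?u")
    and v: "complex_linear (frechet_derivative h (at (conj_act D g)))" (is "complex_linear ?v")
  shows "RE_invariant_part f h (conj_act D g) = (\<Sum>a\<in>UNIV. \<Sum>b\<in>UNIV.
    (d b ^ 2 - d a ^ 2) * ?u (conj_act (munit a b) g) * ?v (conj_act (munit b a) g))"
proof -
  define A where "A = conj_act D g"
  have u': "complex_linear (\<lambda>X. ?u (X ** A))" "complex_linear (\<lambda>X. ?u (A ** X))"
    and v': "complex_linear (\<lambda>X. ?v (X ** A))" "complex_linear (\<lambda>X. ?v (A ** X))"
    using complex_linear_mult [OF u, of "mat 1" A] complex_linear_mult [OF u, of A "mat 1"]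
      complex_linear_mult [OF v, of "mat 1" A] complex_linear_mult [OF v, of A "mat 1"]
    by simp_all
  have uc: "?u (conj_act (munit a b) g ** A) = d b * ?u (conj_act (munit a b) g)"
    "?u (A ** conj_act (munit a b) g) = d a * ?u (conj_act (munit a b) g)" for a b
    using u by (simp_all add: A_def conj_act_commutation [OF g] complex_linear_def)
  have vc: "?v (conj_act (munit a b) g ** A) = d b * ?v (conj_act (munit a b) g)"
    "?v (A ** conj_act (munit a b) g) = d a * ?v (conj_act (munit a b) g)" for a b
    using v by (simp_all add: A_def conj_act_commutation [OF g] complex_linear_def)
  have "RE_invariant_part f h A
      = (\<Sum>a\<in>UNIV. \<Sum>b\<in>UNIV. ?u (munit a b ** A) * ?v (A ** munit b a))
        - (\<Sum>a\<in>UNIV. \<Sum>b\<in>UNIV. ?u (A ** munit a b) * ?v (munit b a ** A))"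
    by (simp add: RE_invariant_part_eq act_l_def act_r_def A_def sum_subtractf)
  also have "\<dots> = (\<Sum>a\<in>UNIV. \<Sum>b\<in>UNIV.
        ?u (conj_act (munit a b) g ** A) * ?v (A ** conj_act (munit b a) g))
      - (\<Sum>a\<in>UNIV. \<Sum>b\<in>UNIV.
        ?u (A ** conj_act (munit a b) g) * ?v (conj_act (munit b a) g ** A))"
    using omega_invariant [OF u'(1) v'(2) g, folded conj_act_def]
      omega_invariant [OF u'(2) v'(1) g, folded conj_act_def] by simp
  also have "\<dots> = (\<Sum>a\<in>UNIV. \<Sum>b\<in>UNIV.
    (d b ^ 2 - d a ^ 2) * ?u (conj_act (munit a b) g) * ?v (conj_act (munit b a) g))"
    unfolding uc vc sum_subtractf [symmetric]
    by (intro sum.cong refl) (simp add: algebra_simps power2_eq_square)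
  finally show ?thesis
    by (simp add: A_def)
qed

text \<open>The two terms of the antisymmetric tensor cover the block pairs \<open>(i, j)\<close>
  and \<open>(j, i)\<close>, so \<open>i < j\<close> accounts for all pairs of distinct blocks;
  inside a block the coefficient vanishes.\<close>

lemma quasi_root_bivector_eq:
  assumes u: "\<And>a b. act_r (munit a b) F g = (d a - d b) * u a b"
    and v: "\<And>a b. act_r (munit a b) H g = (d a - d b) * v a b"
  shows "right_invariant_bivector (quasi_root_bivector ns k ev) F H (g :: 'n cmat)
    = (\<Sum>a\<in>UNIV. \<Sum>b\<in>UNIV. (d b ^ 2 - d a ^ 2) * u a b * v b a)"
proof -
  define G where "G = (\<lambda>a b. (d b ^ 2 - d a ^ 2) * u a b * v b a)"
  \<comment> \<open>The diagonal is set to 0 to fit \<open>sum_pairs_upper\<close>; the next fact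
    shows that this changes nothing.\<close>
  define T where "T = (\<lambda>i j. if i = j then 0 else \<Sum>a\<in>block ns i. \<Sum>b\<in>block ns j. G a b)"
  have T: "(\<Sum>a\<in>block ns i. \<Sum>b\<in>block ns j. G a b) = T i j" if "i \<in> {1..k}" for i j
  proof -
    have "(\<Sum>a\<in>block ns i. \<Sum>b\<in>block ns i. G a b) = 0"
      using that by (intro sum.neutral ballI) (simp add: G_def d_block)
    then show ?thesis
      by (auto simp: T_def)
  qed
  have pair: "(ev i + ev j) / (ev i - ev j) * (\<Sum>\<alpha>\<in>quasi_root ns i j.
      bidiff (tensor (root_vector \<alpha>) (root_vector (- \<alpha>))) act_r act_r F H g
      - bidiff (tensor (root_vector (- \<alpha>)) (root_vector \<alpha>)) act_r act_r F H g) = T i j + T j i"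
    if ij: "i \<in> {1..k}" "j \<in> {1..k}" "i \<noteq> j" for i j
  proof -
    have ne: "ev i - ev j \<noteq> 0"
      using inj_onD [OF inj_ev _ ij(1,2)] ij(3) by auto
    have "(ev i + ev j) / (ev i - ev j) * (\<Sum>\<alpha>\<in>quasi_root ns i j.
        bidiff (tensor (root_vector \<alpha>) (root_vector (- \<alpha>))) act_r act_r F H g
        - bidiff (tensor (root_vector (- \<alpha>)) (root_vector \<alpha>)) act_r act_r F H g)
      = (\<Sum>a\<in>block ns i. \<Sum>b\<in>block ns j. (ev i + ev j) / (ev i - ev j) *
          (act_r (munit a b) F g * act_r (munit b a) H g
           - act_r (munit b a) F g * act_r (munit a b) H g))"
      by (subst sum_quasi_root [OF block_disjoint [OF ij], where
            T = "\<lambda>X Y. bidiff (tensor X Y) act_r act_r F H g - bidiff (tensor Y X) act_r act_r F H g"])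
        (simp add: bidiff_tensor_munit sum_distrib_left)
    also have "\<dots> = (\<Sum>a\<in>block ns i. \<Sum>b\<in>block ns j. G a b + G b a)"
    proof (intro sum.cong refl)
      fix a b :: 'n assume "a \<in> block ns i" "b \<in> block ns j"
      then have ab: "d a = ev i" "d b = ev j"
        using ij by (simp_all add: d_block)
      \<comment> \<open>The variables stand for the values of \<open>u\<close> and \<open>v\<close>
        at \<open>(a, b)\<close> and \<open>(b, a)\<close>.\<close>
      have "(ev i + ev j) / (ev i - ev j) * ((ev i - ev j) * p * ((ev j - ev i) * q)
          - (ev j - ev i) * p' * ((ev i - ev j) * q'))
        = (ev j ^ 2 - ev i ^ 2) * p * q + (ev i ^ 2 - ev j ^ 2) * p' * q'" for p q p' q'
        using ne by (simp add: divide_simps) (simp add: algebra_simps power2_eq_square)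
      then show "(ev i + ev j) / (ev i - ev j) *
          (act_r (munit a b) F g * act_r (munit b a) H g
           - act_r (munit b a) F g * act_r (munit a b) H g) = G a b + G b a"
        by (simp only: u v G_def ab)
    qed
    also have "\<dots> = T i j + T j i"
      unfolding sum.distrib T [OF ij(1), symmetric] T [OF ij(2), symmetric]
      by (simp add: sum.swap [of "\<lambda>a b. G b a"])
    finally show ?thesis .
  qed
  have "right_invariant_bivector (quasi_root_bivector ns k ev) F H g
      = (\<Sum>(i, j)\<in>{(i, j). 1 \<le> i \<and> i < j \<and> j \<le> k}. T i j + T j i)"
    unfolding right_invariant_bivector_def quasi_root_bivector_def bidiff_sum
  proof (intro sum.cong refl)
    fix p assume "p \<in> {(i, j). 1 \<le> i \<and> i < j \<and> j \<le> k}"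
    then obtain i j where "p = (i, j)" "i \<in> {1..k}" "j \<in> {1..k}" "i \<noteq> j"
      by auto
    then show "bidiff (case p of (i, j) \<Rightarrow> ((ev i + ev j) / (ev i - ev j)) *s
        (\<Sum>\<alpha>\<in>quasi_root ns i j. tensor (root_vector \<alpha>) (root_vector (- \<alpha>))
          - tensor (root_vector (- \<alpha>)) (root_vector \<alpha>))) act_r act_r F H g
      = (case p of (i, j) \<Rightarrow> T i j + T j i)"
      using pair [of i j] by (simp add: bidiff_scale bidiff_sum bidiff_diff)
  qed
  also have "\<dots> = (\<Sum>i\<in>{1..k}. \<Sum>j\<in>{1..k}. T i j)"
    by (rule sum_pairs_upper [symmetric]) (simp add: T_def)
  also have "\<dots> = (\<Sum>i\<in>{1..k}. \<Sum>j\<in>{1..k}. \<Sum>a\<in>block ns i. \<Sum>b\<in>block ns j. G a b)"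
    by (simp add: T)
  also have "\<dots> = (\<Sum>i\<in>{1..k}. \<Sum>a\<in>block ns i. \<Sum>j\<in>{1..k}. \<Sum>b\<in>block ns j. G a b)"
    by (intro sum.cong refl sum.swap)
  also have "\<dots> = (\<Sum>a\<in>UNIV. \<Sum>b\<in>UNIV. G a b)"
    by (simp only: sum_blocks)
  finally show ?thesis
    by (simp add: G_def)
qed

text \<open>Both sides have the same expansion in conjugated units. The right side does not mention
  \<open>f\<close> and \<open>h\<close>, which makes the restriction well defined.\<close>

lemma RE_invariant_part_pullback:
  assumes f: "local_extension ns k ev f \<phi> x" "holomorphic_near ns k \<phi> x"
    and h: "local_extension ns k ev h \<eta> x" "holomorphic_near ns k \<eta> x"
    and x: "x \<in> homog ns k" "g \<in> x"
  shows "RE_invariant_part f h (conj_act D g)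
    = right_invariant_bivector (quasi_root_bivector ns k ev)
        (\<phi> \<circ> quot_map ns k) (\<eta> \<circ> quot_map ns k) g"
proof -
  \<comment> \<open>Complex linearity was proved alongside a statement about some \<open>X\<close>;
    the zero matrix serves as that \<open>X\<close>.\<close>
  have "(0 :: 'n cmat) ** 0 = 0 *\<^sub>R 0"
    by simp
  then have "complex_linear (frechet_derivative f (at (conj_act D g)))"
    "complex_linear (frechet_derivative h (at (conj_act D g)))"
    using local_extension_derivative(2) f h x by blast+
  then show ?thesis
    using quasi_root_bivector_eq [OF act_r_pullback [OF f x] act_r_pullback [OF h x]]
    by (simp add: RE_invariant_part_conj_act homog_memberD(1) [OF x])
qed

text \<open>The adjoint fields are tangent to the orbit and lift to left-invariant fields on the
  group, so the part from \<open>r_tensor\<close> is also independent of the extensions.\<close>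

lemma RE_bracket_pullback:
  assumes f: "local_extension ns k ev f \<phi> x" "holomorphic_near ns k \<phi> x"
    and h: "local_extension ns k ev h \<eta> x" "holomorphic_near ns k \<eta> x"
    and x: "x \<in> homog ns k" "g \<in> x"
  shows "RE_bracket f h (conj_act D g)
    = bidiff r_tensor act_l act_l (\<phi> \<circ> quot_map ns k) (\<eta> \<circ> quot_map ns k) g
      + right_invariant_bivector (quasi_root_bivector ns k ev)
        (\<phi> \<circ> quot_map ns k) (\<eta> \<circ> quot_map ns k) g"
proof -
  have idem: "munit a b ** munit a b = (if a = b then 1 else 0 :: real) *\<^sub>R munit a b" for a b :: 'n
    by (simp add: munit_mult_munit)
  have "bidiff r_tensor act_ad act_ad f h (conj_act D g)
      = bidiff r_tensor act_l act_l (\<phi> \<circ> quot_map ns k) (\<eta> \<circ> quot_map ns k) g"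
    unfolding bidiff_def
    by (simp only: local_extension_derivative(1) [OF f x idem] local_extension_derivative(1) [OF h x idem])
  then show ?thesis
    by (simp add: RE_bracket_def RE_invariant_part_pullback [OF f h x])
qed

text \<open>A value common to all pairs of extensions is the unique restricted value, because
  extensions exist.\<close>

lemma restricted_value_iff:
  assumes B: "\<And>f h. local_extension ns k ev f \<phi> x \<Longrightarrow> local_extension ns k ev h \<eta> x \<Longrightarrow>
      B f h (conj_act D g) = \<beta>"
    and x: "x \<in> homog ns k"
    and \<phi>: "holomorphic_near ns k \<phi> x" and \<eta>: "holomorphic_near ns k \<eta> x"
    and g: "g \<in> x"
  shows "restricted_value ns k ev B \<phi> \<eta> x c \<longleftrightarrow> c = \<beta>"
proof -
  have "realize ns k ev x = conj_act D g"
    using homog_memberD [OF x g] by (simp add: realize_quot_map)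
  then show ?thesis
    using B local_extension_exists [OF x \<phi>] local_extension_exists [OF x \<eta>]
    unfolding restricted_value_def by metis
qed

lemma restricts_to_homog_RE_bracket: "restricts_to_homog ns k ev (RE_bracket :: 'n bioperator)"
  unfolding restricts_to_homog_def
proof (intro ballI allI impI)
  fix x :: "'n cmat set" and \<phi> \<eta>
  assume *: "x \<in> homog ns k" "holomorphic_near ns k \<phi> x" "holomorphic_near ns k \<eta> x"
  obtain g where g: "g \<in> x"
    using *(1) by (rule homog_representative)
  from restricted_value_iff [where B = RE_bracket, OF RE_bracket_pullback [OF _ *(2) _ *(3) *(1) g] * g]
  show "\<exists>!c. restricted_value ns k ev RE_bracket \<phi> \<eta> x c"
    by simp
qed

lemma restricts_to_homog_RE_invariant_part:
  "restricts_to_homog ns k ev (RE_invariant_part :: 'n bioperator)"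
  unfolding restricts_to_homog_def
proof (intro ballI allI impI)
  fix x :: "'n cmat set" and \<phi> \<eta>
  assume *: "x \<in> homog ns k" "holomorphic_near ns k \<phi> x" "holomorphic_near ns k \<eta> x"
  obtain g where g: "g \<in> x"
    using *(1) by (rule homog_representative)
  from restricted_value_iff [where B = RE_invariant_part, OF RE_invariant_part_pullback [OF _ *(2) _ *(3) *(1) g] * g]
  show "\<exists>!c. restricted_value ns k ev RE_invariant_part \<phi> \<eta> x c"
    by simp
qed

lemma restricted_RE_invariant_part_induced:
  "induced_by_right_invariant ns k (quasi_root_bivector ns k ev :: 'n tensor2)
    (restricted_bracket ns k ev RE_invariant_part)"
  unfolding induced_by_right_invariant_def restricted_bracket_def
proof (intro ballI allI impI)
  fix x :: "'n cmat set" and \<phi> \<eta> and g :: "'n cmat"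
  assume *: "x \<in> homog ns k" "holomorphic_near ns k \<phi> x" "holomorphic_near ns k \<eta> x" and g: "g \<in> x"
  from restricted_value_iff [where B = RE_invariant_part, OF RE_invariant_part_pullback [OF _ *(2) _ *(3) *(1) g] * g]
  show "(THE c. restricted_value ns k ev RE_invariant_part \<phi> \<eta> x c)
      = right_invariant_bivector (quasi_root_bivector ns k ev)
          (\<phi> \<circ> quot_map ns k) (\<eta> \<circ> quot_map ns k) g"
    by simp
qed

end

section \<open>Consecutive blocks partition the basis\<close>

lemma block_decomposition_exists:
  assumes total: "(\<Sum>i\<in>{1..k}. ns i) = CARD('n::{finite,linorder})" and "inj_on ev {1..k}"
  shows "\<exists>bi :: 'n \<Rightarrow> nat. block_decomposition ns k ev bi"
proof -
  have "\<exists>!i. i \<in> {1..k} \<and> a \<in> block ns i" for a :: 'n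
  proof -
    define s where "s = (\<lambda>i. \<Sum>m\<in>{1..i}. ns m)"
    define c where "c = card {b. b < a}"
    have s_mono: "s i \<le> s j" if "i \<le> j" for i j
      unfolding s_def using that by (intro sum_mono2) auto
    have block: "a \<in> block ns i \<longleftrightarrow> s (i - 1) \<le> c \<and> c < s i" if "i \<ge> 1" for i
    proof -
      have "{1..<i} = {1..i - 1}"
        using that by auto
      then show ?thesis
        by (simp add: block_def s_def c_def)
    qed
    have "c < CARD('n)"
      unfolding c_def by (intro psubset_card_mono) auto
    then have ck: "c < s k"
      by (simp only: s_def total)
    \<comment> \<open>The block of \<open>a\<close> is found at the first partial sum exceeding its
      position \<open>c\<close>; as \<open>s 0 = 0\<close>, this index is at least 1 and
      \<open>i - 1\<close> is its true predecessor.\<close>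
    define i where "i = (LEAST i. c < s i)"
    have i: "c < s i"
      unfolding i_def using ck by (rule LeastI)
    have "i \<le> k"
      unfolding i_def using ck by (rule Least_le)
    have "s 0 = 0"
      by (simp add: s_def)
    then have "i \<ge> 1"
      using i by (cases i) auto
    then have "s (i - 1) \<le> c"
      using not_less_Least [of "i - 1" "\<lambda>i. c < s i"] by (simp add: i_def [symmetric])
    show ?thesis
    proof (rule ex1I [of _ i])
      show "i \<in> {1..k} \<and> a \<in> block ns i"
        using \<open>i \<ge> 1\<close> \<open>i \<le> k\<close> i \<open>s (i - 1) \<le> c\<close> by (simp add: block)
      fix j assume j: "j \<in> {1..k} \<and> a \<in> block ns j"
      then have "s (j - 1) \<le> c" "c < s j"
        using block [of j] by simp_all
      \<comment> \<open>Monotone partial sums make the intervals from \<open>s (i - 1)\<close> to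
        \<open>s i\<close> disjoint, which excludes a smaller and then a larger index.\<close>
      moreover have "\<not> j \<le> i - 1"
        using s_mono [of j "i - 1"] \<open>s (i - 1) \<le> c\<close> \<open>c < s j\<close> by linarith
      moreover have "\<not> i \<le> j - 1"
        using s_mono [of i "j - 1"] \<open>s (j - 1) \<le> c\<close> i by linarith
      ultimately show "j = i"
        by linarith
    qed
  qed
  then obtain bi :: "'n \<Rightarrow> nat" where
    "\<And>a. bi a \<in> {1..k} \<and> a \<in> block ns (bi a)"
    "\<And>a i. i \<in> {1..k} \<Longrightarrow> a \<in> block ns i \<Longrightarrow> bi a = i"
    by metis
  then have "block_decomposition ns k ev bi"
    using assms(2) by unfold_locales auto
  then show ?thesis
    by blast
qed

theorem proposition4p2:
  fixes ns :: "nat \<Rightarrow> nat" and k :: nat and ev :: "nat \<Rightarrow> complex"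
  assumes pos: "\<forall>i\<in>{1..k}. ns i > 0"
    and noninc: "\<forall>i\<in>{1..k}. \<forall>j\<in>{1..k}. i < j \<longrightarrow> ns i \<ge> ns j"
    and total: "(\<Sum>i\<in>{1..k}. ns i) = CARD('n::{finite,linorder})"
    and distinct: "inj_on ev {1..k}"
    and decreasing: "\<forall>i\<in>{1..k}. \<forall>j\<in>{1..k}. i < j \<longrightarrow> psucc (ns i, ev i) (ns j, ev j)"
  shows "bij_betw (realize ns k ev) (homog ns k) (orbit ns k ev :: 'n cmat set)
    \<and> restricts_to_homog ns k ev (RE_bracket :: 'n bioperator)
    \<and> restricts_to_homog ns k ev (RE_invariant_part :: 'n bioperator)
    \<and> induced_by_right_invariant ns k (quasi_root_bivector ns k ev :: 'n tensor2)
        (restricted_bracket ns k ev RE_invariant_part)"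
proof -
  obtain bi :: "'n \<Rightarrow> nat" where "block_decomposition ns k ev bi"
    using block_decomposition_exists [OF total distinct] by blast
  then interpret block_decomposition ns k ev bi .
  show ?thesis
    using bij_betw_realize restricts_to_homog_RE_bracket restricts_to_homog_RE_invariant_part
      restricted_RE_invariant_part_induced by blast
qed

end
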